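(* Let $A$ be a basic finite dimensional algebra over a field $k$ with complete set of orthogonal primitive idempotents $1=e_1+\cdots+e_n$, and let $\epsilon\in\{\pm1\}^n$. Then the isomorphism $K_0(\operatorname{proj}A_\epsilon)_{\mathbb R}\simeq K_0(\operatorname{proj}A)_{\mathbb R}$ induced by $-\otimes_{A_\epsilon}A$ (so $[e_iA_\epsilon]\mapsto[e_iA]$) gives an isomorphism of fans $\Sigma_\epsilon(A_\epsilon)\simeq\Sigma_\epsilon(A)$.
   Context: $e^+_\epsilon:=\sum_{\epsilon_i=1}e_i$, $e^-_\epsilon:=\sum_{\epsilon_i=-1}e_i$, and $A_\epsilon$ is the subalgebra $\begin{pmatrix}e^+_\epsilon Ae^+_\epsilon&e^+_\epsilon Ae^-_\epsilon\\0&e^-_\epsilon Ae^-_\epsilon\end{pmatrix}$ of $A$; the $e_i$ also form a complete set of orthogonal primitive idempotents of $A_\epsilon$. For an algebra $\Lambda$ with such idempotents $e_i$: 2-term presilting complexes in $\mathsf{K}^{\rm b}(\operatorname{proj}\Lambda)$ are complexes concentrated in degrees $-1,0$ with $\operatorname{Hom}(T,T[\ell])=0$ for $\ell>0$; for basic such $T=T_1\oplus\cdots\oplus T_j$ ($T_i$ indecomposable), $C(T)=\{\sum a_i[T_i]\mid a_i\ge0\}$; $\Sigma(\Lambda)$ is the set of all these cones; the orthant is $K_0(\operatorname{proj}\Lambda)_{\epsilon,\mathbb R}=\operatorname{cone}\{\epsilon_i[e_i\Lambda]\mid 1\le i\le n\}$ and $\Sigma_\epsilon(\Lambda):=\{\sigma\in\Sigma(\Lambda)\mid\sigma\subset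 K_0(\operatorname{proj}\Lambda)_{\epsilon,\mathbb R}\}$. An isomorphism of fans is a lattice isomorphism whose linear extension maps cones bijectively to cones. *)

theory Defs
  imports Complex_Main
begin

definition k_algebra :: "('k::field \<Rightarrow> 'a::ring_1 \<Rightarrow> 'a) \<Rightarrow> bool" where
  "k_algebra scale \<longleftrightarrow>
     (\<forall>c x y. scale c (x + y) = scale c x + scale c y) \<and>
     (\<forall>c d x. scale (c + d) x = scale c x + scale d x) \<and>
     (\<forall>c d x. scale (c * d) x = scale c (scale d x)) \<and>
     (\<forall>x. scale 1 x = x) \<and>
     (\<forall>c x y. scale c (x * y) = scale c x * y \<and> scale c (x * y) = x * scale c y)"

definition finite_dimensional_alg :: "('k::field \<Rightarrow> 'a::ring_1 \<Rightarrow> 'a) \<Rightarrow> bool" where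
  "finite_dimensional_alg scale \<longleftrightarrow>
     (\<exists>B. finite B \<and> (\<forall>x. \<exists>c. x = (\<Sum>b\<in>B. scale (c b) b)))"

definition primitive_idem :: "'a::ring_1 \<Rightarrow> bool" where
  "primitive_idem x \<longleftrightarrow> x * x = x \<and> x \<noteq> 0 \<and>
     (\<forall>f g. f * f = f \<and> g * g = g \<and> f * g = 0 \<and> g * f = 0 \<and> x = f + g \<longrightarrow> f = 0 \<or> g = 0)"

definition complete_orth_prim_idems :: "nat \<Rightarrow> (nat \<Rightarrow> 'a::ring_1) \<Rightarrow> bool" where
  "complete_orth_prim_idems n e \<longleftrightarrow>
     (\<Sum>i<n. e i) = 1 \<and>
     (\<forall>i<n. \<forall>j<n. i \<noteq> j \<longrightarrow> e i * e j = 0) \<and>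
     (\<forall>i<n. primitive_idem (e i))"

text \<open>Basic: the indecomposable projectives e i A are pairwise non-isomorphic.
 Hom(e_i A, e_j A) = e_j A e_i (left multiplication).\<close>

definition basic_alg :: "nat \<Rightarrow> (nat \<Rightarrow> 'a::ring_1) \<Rightarrow> bool" where
  "basic_alg n e \<longleftrightarrow>
     (\<forall>i<n. \<forall>j<n. i \<noteq> j \<longrightarrow>
        \<not> (\<exists>x y. x = e j * x * e i \<and> y = e i * y * e j \<and> y * x = e i \<and> x * y = e j))"

definition sign_vec :: "nat \<Rightarrow> (nat \<Rightarrow> int) \<Rightarrow> bool" where
  "sign_vec n eps \<longleftrightarrow> (\<forall>i<n. eps i = 1 \<or> eps i = -1)"

definition e_plus :: "nat \<Rightarrow> (nat \<Rightarrow> 'a::ring_1) \<Rightarrow> (nat \<Rightarrow> int) \<Rightarrow> 'a" where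
  "e_plus n e eps = (\<Sum>i\<in>{i. i < n \<and> eps i = 1}. e i)"

definition e_minus :: "nat \<Rightarrow> (nat \<Rightarrow> 'a::ring_1) \<Rightarrow> (nat \<Rightarrow> int) \<Rightarrow> 'a" where
  "e_minus n e eps = (\<Sum>i\<in>{i. i < n \<and> eps i = -1}. e i)"

definition A_eps :: "nat \<Rightarrow> (nat \<Rightarrow> 'a::ring_1) \<Rightarrow> (nat \<Rightarrow> int) \<Rightarrow> 'a set" where
  "A_eps n e eps =
     (let p = e_plus n e eps; m = e_minus n e eps in
      {p * x * p + p * y * m + m * z * m | x y z. True})"

text \<open>An algebra Lambda is given as a subalgebra L of the ambient ring containing the e i.
 A finitely generated projective right Lambda-module is a direct sum of the e_i Lambda, encoded
 by a list of indices; a morphism (e_{p_1}+...)Lambda -> (e_{q_1}+...)Lambda is a matrix M with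
 M q p in e_{q} Lambda e_{p} (acting by left multiplication).\<close>

definition hom :: "'a::ring_1 set \<Rightarrow> (nat \<Rightarrow> 'a) \<Rightarrow> nat list \<Rightarrow> nat list \<Rightarrow> (nat \<Rightarrow> nat \<Rightarrow> 'a) \<Rightarrow> bool" where
  "hom L e ps qs M \<longleftrightarrow>
     (\<forall>q<length qs. \<forall>p<length ps. M q p \<in> L \<and> M q p = e (qs ! q) * M q p * e (ps ! p))"

definition mmul :: "nat \<Rightarrow> (nat \<Rightarrow> nat \<Rightarrow> 'a::ring_1) \<Rightarrow> (nat \<Rightarrow> nat \<Rightarrow> 'a) \<Rightarrow> nat \<Rightarrow> nat \<Rightarrow> 'a" where
  "mmul k M N = (\<lambda>q p. \<Sum>r<k. M q r * N r p)"

definition madd :: "(nat \<Rightarrow> nat \<Rightarrow> 'a::ring_1) \<Rightarrow> (nat \<Rightarrow> nat \<Rightarrow> 'a) \<Rightarrow> nat \<Rightarrow> nat \<Rightarrow> 'a" where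
  "madd M N = (\<lambda>q p. M q p + N q p)"

definition msub :: "(nat \<Rightarrow> nat \<Rightarrow> 'a::ring_1) \<Rightarrow> (nat \<Rightarrow> nat \<Rightarrow> 'a) \<Rightarrow> nat \<Rightarrow> nat \<Rightarrow> 'a" where
  "msub M N = (\<lambda>q p. M q p - N q p)"

definition meq :: "nat \<Rightarrow> nat \<Rightarrow> (nat \<Rightarrow> nat \<Rightarrow> 'a) \<Rightarrow> (nat \<Rightarrow> nat \<Rightarrow> 'a) \<Rightarrow> bool" where
  "meq m k M N \<longleftrightarrow> (\<forall>q<m. \<forall>p<k. M q p = N q p)"

definition idm :: "(nat \<Rightarrow> 'a::ring_1) \<Rightarrow> nat list \<Rightarrow> nat \<Rightarrow> nat \<Rightarrow> 'a" where
  "idm e ps = (\<lambda>q p. if q = p then e (ps ! p) else 0)"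

text \<open>A 2-term complex T: (P^{-1}, P^0, d : P^{-1} -> P^0).\<close>

type_synonym 'a cplx = "nat list \<times> nat list \<times> (nat \<Rightarrow> nat \<Rightarrow> 'a)"

definition deg1 :: "'a cplx \<Rightarrow> nat list" where "deg1 T = fst T"
definition deg0 :: "'a cplx \<Rightarrow> nat list" where "deg0 T = fst (snd T)"
definition dif :: "'a cplx \<Rightarrow> nat \<Rightarrow> nat \<Rightarrow> 'a" where "dif T = snd (snd T)"

definition valid_cplx :: "'a::ring_1 set \<Rightarrow> (nat \<Rightarrow> 'a) \<Rightarrow> nat \<Rightarrow> 'a cplx \<Rightarrow> bool" where
  "valid_cplx L e n T \<longleftrightarrow>
     set (deg1 T) \<subseteq> {..<n} \<and> set (deg0 T) \<subseteq> {..<n} \<and> hom L e (deg1 T) (deg0 T) (dif T)"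

definition chain_map :: "'a::ring_1 set \<Rightarrow> (nat \<Rightarrow> 'a) \<Rightarrow> 'a cplx \<Rightarrow> 'a cplx
    \<Rightarrow> (nat \<Rightarrow> nat \<Rightarrow> 'a) \<Rightarrow> (nat \<Rightarrow> nat \<Rightarrow> 'a) \<Rightarrow> bool" where
  "chain_map L e T T' f1 f0 \<longleftrightarrow>
     hom L e (deg1 T) (deg1 T') f1 \<and> hom L e (deg0 T) (deg0 T') f0 \<and>
     meq (length (deg0 T')) (length (deg1 T))
       (mmul (length (deg0 T)) f0 (dif T)) (mmul (length (deg1 T')) (dif T') f1)"

definition null_htpc :: "'a::ring_1 set \<Rightarrow> (nat \<Rightarrow> 'a) \<Rightarrow> 'a cplx \<Rightarrow> 'a cplx
    \<Rightarrow> (nat \<Rightarrow> nat \<Rightarrow> 'a) \<Rightarrow> (nat \<Rightarrow> nat \<Rightarrow> 'a) \<Rightarrow> bool" where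
  "null_htpc L e T T' f1 f0 \<longleftrightarrow>
     (\<exists>h. hom L e (deg0 T) (deg1 T') h \<and>
        meq (length (deg0 T')) (length (deg0 T)) f0 (mmul (length (deg1 T')) (dif T') h) \<and>
        meq (length (deg1 T')) (length (deg1 T)) f1 (mmul (length (deg0 T)) h (dif T)))"

definition homeq :: "'a::ring_1 set \<Rightarrow> (nat \<Rightarrow> 'a) \<Rightarrow> 'a cplx \<Rightarrow> 'a cplx \<Rightarrow> bool" where
  "homeq L e T T' \<longleftrightarrow>
     (\<exists>f1 f0 g1 g0. chain_map L e T T' f1 f0 \<and> chain_map L e T' T g1 g0 \<and>
        null_htpc L e T T
          (msub (mmul (length (deg1 T')) g1 f1) (idm e (deg1 T)))
          (msub (mmul (length (deg0 T')) g0 f0) (idm e (deg0 T))) \<and>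
        null_htpc L e T' T'
          (msub (mmul (length (deg1 T)) f1 g1) (idm e (deg1 T')))
          (msub (mmul (length (deg0 T)) f0 g0) (idm e (deg0 T'))))"

definition zero_K :: "'a::ring_1 set \<Rightarrow> (nat \<Rightarrow> 'a) \<Rightarrow> 'a cplx \<Rightarrow> bool" where
  "zero_K L e T \<longleftrightarrow> null_htpc L e T T (idm e (deg1 T)) (idm e (deg0 T))"

definition dsum :: "'a::ring_1 cplx \<Rightarrow> 'a cplx \<Rightarrow> 'a cplx" where
  "dsum T1 T2 =
     (deg1 T1 @ deg1 T2, deg0 T1 @ deg0 T2,
      (\<lambda>q p. if q < length (deg0 T1) then
                (if p < length (deg1 T1) then dif T1 q p else 0)
             else (if p < length (deg1 T1) then 0
                   else dif T2 (q - length (deg0 T1)) (p - length (deg1 T1)))))"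

definition zero_cplx :: "'a::ring_1 cplx" where
  "zero_cplx = ([], [], (\<lambda>q p. 0))"

definition dsum_list :: "'a::ring_1 cplx list \<Rightarrow> 'a cplx" where
  "dsum_list Ts = foldr dsum Ts zero_cplx"

text \<open>Hom(T, T[l]) = 0 for all l > 0. For 2-term complexes only l = 1 is nontrivial, and
 Hom_K(T, T[1]) = 0 means every g : P^{-1} -> P^0 is of the form d a + b d.\<close>

definition presilting :: "'a::ring_1 set \<Rightarrow> (nat \<Rightarrow> 'a) \<Rightarrow> 'a cplx \<Rightarrow> bool" where
  "presilting L e T \<longleftrightarrow>
     (\<forall>g. hom L e (deg1 T) (deg0 T) g \<longrightarrow>
        (\<exists>a b. hom L e (deg1 T) (deg1 T) a \<and> hom L e (deg0 T) (deg0 T) b \<and>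
           meq (length (deg0 T)) (length (deg1 T)) g
             (madd (mmul (length (deg1 T)) (dif T) a) (mmul (length (deg0 T)) b (dif T)))))"

definition indecomposable :: "'a::ring_1 set \<Rightarrow> (nat \<Rightarrow> 'a) \<Rightarrow> nat \<Rightarrow> 'a cplx \<Rightarrow> bool" where
  "indecomposable L e n T \<longleftrightarrow>
     \<not> zero_K L e T \<and>
     \<not> (\<exists>T1 T2. valid_cplx L e n T1 \<and> valid_cplx L e n T2 \<and>
           \<not> zero_K L e T1 \<and> \<not> zero_K L e T2 \<and> homeq L e T (dsum T1 T2))"

text \<open>Class [T] = [P^0] - [P^{-1}] in K_0(proj Lambda)_R = R^n, in the basis [e_i Lambda];
 vectors are functions nat => real (coordinates >= n are zero).\<close>

definition cls :: "'a cplx \<Rightarrow> nat \<Rightarrow> real" where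
  "cls T = (\<lambda>i. real (count_list (deg0 T) i) - real (count_list (deg1 T) i))"

definition cone_gen :: "(nat \<Rightarrow> real) set \<Rightarrow> (nat \<Rightarrow> real) set" where
  "cone_gen S = {(\<lambda>i. \<Sum>v\<in>F. c v * v i) | F c. finite F \<and> F \<subseteq> S \<and> (\<forall>v\<in>F. c v \<ge> 0)}"

definition basic_presilting_decomp :: "'a::ring_1 set \<Rightarrow> (nat \<Rightarrow> 'a) \<Rightarrow> nat \<Rightarrow> 'a cplx list \<Rightarrow> bool" where
  "basic_presilting_decomp L e n Ts \<longleftrightarrow>
     (\<forall>T\<in>set Ts. valid_cplx L e n T \<and> indecomposable L e n T) \<and>
     (\<forall>i<length Ts. \<forall>j<length Ts. i \<noteq> j \<longrightarrow> \<not> homeq L e (Ts ! i) (Ts ! j)) \<and>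
     presilting L e (dsum_list Ts)"

definition Sigma_fan :: "'a::ring_1 set \<Rightarrow> (nat \<Rightarrow> 'a) \<Rightarrow> nat \<Rightarrow> (nat \<Rightarrow> real) set set" where
  "Sigma_fan L e n = {cone_gen (set (map cls Ts)) | Ts. basic_presilting_decomp L e n Ts}"

definition orthant :: "nat \<Rightarrow> (nat \<Rightarrow> int) \<Rightarrow> (nat \<Rightarrow> real) set" where
  "orthant n eps = cone_gen {(\<lambda>j. if j = i then real_of_int (eps i) else 0) | i. i < n}"

definition Sigma_eps :: "'a::ring_1 set \<Rightarrow> (nat \<Rightarrow> 'a) \<Rightarrow> nat \<Rightarrow> (nat \<Rightarrow> int) \<Rightarrow> (nat \<Rightarrow> real) set set" where
  "Sigma_eps L e n eps = {\<sigma> \<in> Sigma_fan L e n. \<sigma> \<subseteq> orthant n eps}"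

definition Rn :: "nat \<Rightarrow> (nat \<Rightarrow> real) set" where
  "Rn n = {x. \<forall>i\<ge>n. x i = 0}"

definition Zn :: "nat \<Rightarrow> (nat \<Rightarrow> real) set" where
  "Zn n = {x \<in> Rn n. \<forall>i. x i \<in> \<int>}"

definition fan_iso :: "nat \<Rightarrow> ((nat \<Rightarrow> real) \<Rightarrow> (nat \<Rightarrow> real)) \<Rightarrow> (nat \<Rightarrow> real) set set
    \<Rightarrow> (nat \<Rightarrow> real) set set \<Rightarrow> bool" where
  "fan_iso n \<phi> S1 S2 \<longleftrightarrow>
     (\<forall>x\<in>Rn n. \<forall>y\<in>Rn n. \<phi> (\<lambda>i. x i + y i) = (\<lambda>i. \<phi> x i + \<phi> y i)) \<and>
     (\<forall>x\<in>Rn n. \<forall>c. \<phi> (\<lambda>i. c * x i) = (\<lambda>i. c * \<phi> x i)) \<and>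
     \<phi> ` Rn n \<subseteq> Rn n \<and>
     bij_betw \<phi> (Zn n) (Zn n) \<and>
     bij_betw (\<lambda>\<sigma>. \<phi> ` \<sigma>) S1 S2"

text \<open>The map K_0(proj A_eps)_R -> K_0(proj A)_R induced by - (x)_{A_eps} A sends
 [e_i A_eps] to [e_i A]; in the coordinates given by these bases it is the identity.\<close>

definition K0_induced :: "nat \<Rightarrow> (nat \<Rightarrow> real) \<Rightarrow> (nat \<Rightarrow> real)" where
  "K0_induced n x = (\<lambda>i. \<Sum>j<n. x j * (if i = j then 1 else 0))"

end

theory Submission
  imports Defs
begin

text \<open>
  Gaussian elimination replaces every two-term complex by a homotopy equivalent minimal one (the
  differential has radical entries) with the same class. In a minimal presilting complex the degree
  -1 and degree 0 parts share no summand, so a class in the orthant of \<open>\<epsilon>\<close> forces the degree 0 part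
  to lie in \<open>add e\<^sup>+\<close> and the degree -1 part in \<open>add e\<^sup>-\<close>. Morphisms, chain maps and rigidity
  between complexes of this shape only involve \<open>e\<^sup>+Ae\<^sup>+\<close>, \<open>e\<^sup>+Ae\<^sup>-\<close> and \<open>e\<^sup>-Ae\<^sup>-\<close>, which \<open>A\<close> and \<open>A\<^sub>\<epsilon>\<close>
  share. Only homotopies see \<open>e\<^sup>-Ae\<^sup>+\<close>; as \<open>A\<close> is basic, these maps are radical, hence homotopy
  equivalence coincides with isomorphism of complexes and indecomposability is the same over both
  algebras.
\<close>

section \<open>Finitely supported matrices\<close>

text \<open>The definitions leave a matrix arbitrary outside the ranges of its index lists and
  compare matrices only there. Finitely supported matrices put all of them into one ring without
  unit, in which projectives are diagonal idempotents and the homotopy theory of two-term complexes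
  is ring arithmetic. Both algebras are subsets of the ambient \<open>A\<close>, so one matrix can
  be read over either of them. The radical is always that of \<open>A\<close>: a subalgebra
  containing the corners e_i A e_i contains the inverses taken in them, and elements of e_i A e_j
  with distinct i, j are radical because \<open>A\<close> is basic. The delicate point is
  indecomposability. A decomposition over one algebra may use complexes of any shape and homotopies
  that the other algebra lacks. Once the summands are minimal, however, they are retracts of a
  complex of known shape, and comparing the sets of indices that occur in each degree shows that
  they have this shape too.\<close>

typedef (overloaded) 'a fmat =
  "{M :: nat \<Rightarrow> nat \<Rightarrow> 'a::zero. \<exists>k. \<forall>q p. k \<le> q \<or> k \<le> p \<longrightarrow> M q p = 0}"
  morphisms entry Abs_fmat
  by (rule exI[of _ "\<lambda>_ _. 0"]) simp

lemma fmat_eqI: "(\<And>q p. entry A q p = entry B q p) \<Longrightarrow> A = B"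
  by (simp add: entry_inject[symmetric] ext)

lemma entry_bounded:
  obtains k where "\<And>q p. k \<le> q \<or> k \<le> p \<Longrightarrow> entry A q p = 0"
  using entry[of A] by blast

lemma entry_Abs_fmat:
  assumes "\<And>q p. k \<le> q \<or> k \<le> p \<Longrightarrow> M q p = 0"
  shows "entry (Abs_fmat M) = M"
  using assms by (intro Abs_fmat_inverse) blast

instantiation fmat :: (ring) ring
begin

definition "0 = Abs_fmat (\<lambda>_ _. 0)"
definition "A + B = Abs_fmat (\<lambda>q p. entry A q p + entry B q p)"
definition "A - B = Abs_fmat (\<lambda>q p. entry A q p - entry B q p)"
definition "- A = Abs_fmat (\<lambda>q p. - entry A q p)"
definition "A * B = Abs_fmat (\<lambda>q p. \<Sum>r | entry A q r \<noteq> 0. entry A q r * entry B r p)"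

lemma entry_zero [simp]: "entry 0 q p = 0"
  unfolding zero_fmat_def by (subst entry_Abs_fmat[of 0]) auto

lemma entry_add [simp]: "entry (A + B) q p = entry A q p + entry B q p"
proof -
  obtain k l where "\<And>q p. k \<le> q \<or> k \<le> p \<Longrightarrow> entry A q p = 0"
    "\<And>q p. l \<le> q \<or> l \<le> p \<Longrightarrow> entry B q p = 0"
    by (metis entry_bounded)
  then show ?thesis
    unfolding plus_fmat_def by (subst entry_Abs_fmat[of "max k l"]) auto
qed

lemma entry_diff [simp]: "entry (A - B) q p = entry A q p - entry B q p"
proof -
  obtain k l where "\<And>q p. k \<le> q \<or> k \<le> p \<Longrightarrow> entry A q p = 0"
    "\<And>q p. l \<le> q \<or> l \<le> p \<Longrightarrow> entry B q p = 0"
    by (metis entry_bounded)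
  then show ?thesis
    unfolding minus_fmat_def by (subst entry_Abs_fmat[of "max k l"]) auto
qed

lemma entry_uminus [simp]: "entry (- A) q p = - entry A q p"
proof -
  obtain k where "\<And>q p. k \<le> q \<or> k \<le> p \<Longrightarrow> entry A q p = 0"
    by (metis entry_bounded)
  then show ?thesis
    unfolding uminus_fmat_def by (subst entry_Abs_fmat[of k]) auto
qed

text \<open>The defining sum runs over the finite support of a row. Any initial segment that catches
  all nonzero terms gives the same value, so a list length or the successor of a single index can
  serve as bound.\<close>

lemma entry_mult:
  assumes "\<And>r. k \<le> r \<Longrightarrow> entry A q r * entry B r p = 0"
  shows "entry (A * B) q p = (\<Sum>r<k. entry A q r * entry B r p)"
proof -
  obtain l where l: "\<And>q p. l \<le> q \<or> l \<le> p \<Longrightarrow> entry A q p = 0"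
    by (metis entry_bounded)
  obtain m where m: "\<And>q p. m \<le> q \<or> m \<le> p \<Longrightarrow> entry B q p = 0"
    by (metis entry_bounded)
  have fin: "finite {r. entry A q r \<noteq> 0}"
    by (rule finite_subset[of _ "{..<l}"]) (use l in \<open>auto simp: not_le[symmetric]\<close>)
  have "entry (A * B) q p = (\<Sum>r | entry A q r \<noteq> 0. entry A q r * entry B r p)"
    unfolding times_fmat_def using l m by (subst entry_Abs_fmat[of "max l m"]) auto
  also have "\<dots> = (\<Sum>r<k. entry A q r * entry B r p)"
    using fin assms by (intro sum.mono_neutral_cong) (auto simp: not_less)
  finally show ?thesis .
qed

text \<open>The bound depends on the left factor alone. One bound then serves all right factors, and
  several products can be expanded over a common range, where the order of summation may be
  exchanged.\<close>

lemma entry_mult_large: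
  obtains k where "\<And>l q p B. k \<le> l \<Longrightarrow> entry (A * B) q p = (\<Sum>r<l. entry A q r * entry B r p)"
proof -
  obtain k where "\<And>q p. k \<le> q \<or> k \<le> p \<Longrightarrow> entry A q p = 0"
    by (metis entry_bounded)
  then have "\<And>l q p B. k \<le> l \<Longrightarrow> entry (A * B) q p = (\<Sum>r<l. entry A q r * entry B r p)"
    by (intro entry_mult) auto
  with that show thesis .
qed

instance
proof
  fix A B C :: "'a fmat"
  obtain k where k: "\<And>l q p B. k \<le> l \<Longrightarrow> entry (A * B) q p = (\<Sum>r<l. entry A q r * entry B r p)"
    by (rule entry_mult_large[of A]) blast
  obtain m where m: "\<And>l q p C. m \<le> l \<Longrightarrow> entry (B * C) q p = (\<Sum>r<l. entry B q r * entry C r p)"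
    by (rule entry_mult_large[of B]) blast
  obtain j where j: "\<And>l q p D. j \<le> l \<Longrightarrow> entry ((A * B) * D) q p = (\<Sum>r<l. entry (A * B) q r * entry D r p)"
    by (rule entry_mult_large[of "A * B"]) blast
  obtain i where i: "\<And>l q p D. i \<le> l \<Longrightarrow> entry ((A + B) * D) q p = (\<Sum>r<l. entry (A + B) q r * entry D r p)"
    by (rule entry_mult_large[of "A + B"]) blast
  define l where "l = k + m + j + i"
  have le: "k \<le> l" "m \<le> l" "j \<le> l" "i \<le> l" by (auto simp: l_def)
  show "A * B * C = A * (B * C)"
  proof (rule fmat_eqI)
    fix q p
    have "entry (A * B * C) q p = (\<Sum>s<l. (\<Sum>r<l. entry A q r * entry B r s) * entry C s p)"
      using le by (simp add: j k)
    also have "\<dots> = (\<Sum>s<l. \<Sum>r<l. entry A q r * (entry B r s * entry C s p))"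
      by (simp add: sum_distrib_right mult.assoc)
    also have "\<dots> = (\<Sum>r<l. \<Sum>s<l. entry A q r * (entry B r s * entry C s p))"
      by (rule sum.swap)
    also have "\<dots> = entry (A * (B * C)) q p"
      using le by (simp add: k m sum_distrib_left)
    finally show "entry (A * B * C) q p = entry (A * (B * C)) q p" .
  qed
  show "(A + B) * C = A * C + B * C"
    by (rule fmat_eqI) (use le in \<open>simp add: i k m sum.distrib distrib_right\<close>)
  show "A * (B + C) = A * B + A * C"
    by (rule fmat_eqI) (use le in \<open>simp add: k sum.distrib distrib_left\<close>)
qed (rule fmat_eqI; simp)+

end

text \<open>Cutting off the entries outside the ranges turns the relation \<open>meq\<close> into
  equality.\<close>

definition trunc :: "nat \<Rightarrow> nat \<Rightarrow> (nat \<Rightarrow> nat \<Rightarrow> 'a::zero) \<Rightarrow> 'a fmat" where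
  "trunc m k M = Abs_fmat (\<lambda>q p. if q < m \<and> p < k then M q p else 0)"

lemma entry_trunc [simp]: "entry (trunc m k M) q p = (if q < m \<and> p < k then M q p else 0)"
  unfolding trunc_def by (subst entry_Abs_fmat[of "max m k"]) auto

lemma trunc_mmul: "trunc m k (mmul r M N) = trunc m r M * trunc r k N"
  by (rule fmat_eqI) (auto simp: mmul_def entry_mult[of r])

lemma trunc_madd: "trunc m k (madd M N) = trunc m k M + trunc m k N"
  by (rule fmat_eqI) (auto simp: madd_def)

lemma trunc_msub: "trunc m k (msub M N) = trunc m k M - trunc m k N"
  by (rule fmat_eqI) (auto simp: msub_def)

lemma meq_iff_trunc: "meq m k M N \<longleftrightarrow> trunc m k M = trunc m k N"
proof
  assume "meq m k M N"
  then show "trunc m k M = trunc m k N" by (intro fmat_eqI) (simp add: meq_def)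
next
  assume eq: "trunc m k M = trunc m k N"
  have "M q p = N q p" if "q < m" "p < k" for q p
    using that arg_cong[OF eq, of "\<lambda>A. entry A q p"] by simp
  then show "meq m k M N" by (simp add: meq_def)
qed

definition single :: "nat \<Rightarrow> nat \<Rightarrow> 'a::zero \<Rightarrow> 'a fmat" where
  "single q p x = Abs_fmat (\<lambda>i j. if i = q \<and> j = p then x else 0)"

lemma entry_single [simp]: "entry (single q p x) i j = (if i = q \<and> j = p then x else 0)"
  unfolding single_def by (subst entry_Abs_fmat[of "Suc (max q p)"]) auto

lemma entry_mult_single:
  "entry (A * single s t x) q p = (if p = t then entry A q s * x else 0)" for x :: "'a::ring"
  by (subst entry_mult[of "Suc s"]) auto

lemma entry_single_mult:
  "entry (single s t x * A) q p = (if q = s then x * entry A t p else 0)" for x :: "'a::ring"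
  by (subst entry_mult[of "Suc t"]) auto

definition mats :: "'a::zero set \<Rightarrow> 'a fmat set" where
  "mats L = {A. \<forall>q p. entry A q p \<in> L}"

text \<open>The diagonal idempotent that stands for the projective module encoded by
  \<open>ps\<close>.\<close>

definition ids :: "(nat \<Rightarrow> 'a::zero) \<Rightarrow> nat list \<Rightarrow> 'a fmat" where
  "ids e ps = Abs_fmat (\<lambda>q p. if q = p \<and> p < length ps then e (ps ! p) else 0)"

lemma entry_ids [simp]:
  "entry (ids e ps) q p = (if q = p \<and> p < length ps then e (ps ! p) else 0)"
  unfolding ids_def by (subst entry_Abs_fmat[of "length ps"]) auto

lemma trunc_idm: "trunc (length ps) (length ps) (idm e ps) = ids e ps"
  by (rule fmat_eqI) (auto simp: idm_def)

lemma entry_mult_ids: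
  "entry (A * ids e ps) q p = (if p < length ps then entry A q p * e (ps ! p) else 0)"
  for A :: "'a::ring fmat"
  by (subst entry_mult[of "length ps"]) (auto simp: if_distrib[of "\<lambda>x. _ * x"] cong: if_cong)

lemma entry_ids_mult:
  "entry (ids e ps * A) q p = (if q < length ps then e (ps ! q) * entry A q p else 0)"
  for A :: "'a::ring fmat"
  by (subst entry_mult[of "length ps"])
     (auto simp: if_distrib[of "\<lambda>x. x * _"] cong: if_cong)

section \<open>Two-term complexes over a ring without unit\<close>

text \<open>Idempotents of a ring stand for projective modules: a triple \<open>(P, Q, d)\<close> encodes the complex
  \<open>d : P \<rightarrow> Q\<close> in degrees -1 and 0.\<close>

type_synonym 'r cpx = "'r \<times> 'r \<times> 'r"

text \<open>\<open>S\<close> will be the set of matrices over a subalgebra. It is a subset of one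
  ring type, not a type of its own, so that complexes over different subalgebras can be compared
  without any coercion.\<close>

locale subrng =
  fixes S :: "'r::ring set"
  assumes zero_closed: "0 \<in> S"
    and add_closed: "x \<in> S \<Longrightarrow> y \<in> S \<Longrightarrow> x + y \<in> S"
    and diff_closed: "x \<in> S \<Longrightarrow> y \<in> S \<Longrightarrow> x - y \<in> S"
    and mult_closed: "x \<in> S \<Longrightarrow> y \<in> S \<Longrightarrow> x * y \<in> S"
begin

lemma uminus_closed: "x \<in> S \<Longrightarrow> - x \<in> S"
  using diff_closed[OF zero_closed, of x] by simp

definition Hom :: "'r \<Rightarrow> 'r \<Rightarrow> 'r \<Rightarrow> bool" where
  "Hom P Q x \<longleftrightarrow> x \<in> S \<and> Q * x = x \<and> x * P = x"

lemma Hom_add: "Hom P Q x \<Longrightarrow> Hom P Q y \<Longrightarrow> Hom P Q (x + y)"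
  by (simp add: Hom_def add_closed algebra_simps)

lemma Hom_diff: "Hom P Q x \<Longrightarrow> Hom P Q y \<Longrightarrow> Hom P Q (x - y)"
  by (simp add: Hom_def diff_closed algebra_simps)

lemma Hom_uminus: "Hom P Q x \<Longrightarrow> Hom P Q (- x)"
  by (simp add: Hom_def uminus_closed)

lemma Hom_zero: "Hom P Q 0"
  by (simp add: Hom_def zero_closed)

lemma Hom_comp: "Hom P Q x \<Longrightarrow> Hom Q R y \<Longrightarrow> Hom P R (y * x)"
  by (simp add: Hom_def mult_closed mult.assoc) (simp add: mult.assoc[symmetric])

fun obj :: "'r cpx \<Rightarrow> bool" where
  "obj (P, Q, d) \<longleftrightarrow> Hom P P P \<and> Hom Q Q Q \<and> Hom P Q d"

fun cmap :: "'r cpx \<Rightarrow> 'r cpx \<Rightarrow> 'r \<Rightarrow> 'r \<Rightarrow> bool" where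
  "cmap (P, Q, d) (P', Q', d') f1 f0 \<longleftrightarrow> Hom P P' f1 \<and> Hom Q Q' f0 \<and> f0 * d = d' * f1"

fun null :: "'r cpx \<Rightarrow> 'r cpx \<Rightarrow> 'r \<Rightarrow> 'r \<Rightarrow> bool" where
  "null (P, Q, d) (P', Q', d') f1 f0 \<longleftrightarrow> (\<exists>h. Hom Q P' h \<and> f0 = d' * h \<and> f1 = h * d)"

fun heq :: "'r cpx \<Rightarrow> 'r cpx \<Rightarrow> bool" where
  "heq (P, Q, d) (P', Q', d') \<longleftrightarrow>
     (\<exists>f1 f0 g1 g0. cmap (P, Q, d) (P', Q', d') f1 f0 \<and> cmap (P', Q', d') (P, Q, d) g1 g0 \<and>
        null (P, Q, d) (P, Q, d) (g1 * f1 - P) (g0 * f0 - Q) \<and>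
        null (P', Q', d') (P', Q', d') (f1 * g1 - P') (f0 * g0 - Q'))"

text \<open>Half of a homotopy equivalence: the first complex is a direct summand of the second up
  to homotopy. Rigidity and contractibility descend along it, which treats direct summands and
  homotopy equivalences together.\<close>

fun retract :: "'r cpx \<Rightarrow> 'r cpx \<Rightarrow> bool" where
  "retract (P, Q, d) (P', Q', d') \<longleftrightarrow>
     (\<exists>f1 f0 g1 g0. cmap (P, Q, d) (P', Q', d') f1 f0 \<and> cmap (P', Q', d') (P, Q, d) g1 g0 \<and>
        null (P, Q, d) (P, Q, d) (g1 * f1 - P) (g0 * f0 - Q))"

text \<open>This is Hom(T, T'[1]) = 0 in the homotopy category. With two arguments the condition is
  additive in each, so that presilting of a direct sum becomes a condition on pairs of
  summands.\<close>

fun rigid :: "'r cpx \<Rightarrow> 'r cpx \<Rightarrow> bool" where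
  "rigid (P, Q, d) (P', Q', d') \<longleftrightarrow>
     (\<forall>x. Hom P Q' x \<longrightarrow> (\<exists>a b. Hom P P' a \<and> Hom Q Q' b \<and> x = d' * a + b * d))"

fun contractible :: "'r cpx \<Rightarrow> bool" where
  "contractible (P, Q, d) \<longleftrightarrow> null (P, Q, d) (P, Q, d) P Q"

lemma cmap_comp:
  assumes "cmap T T' f1 f0" "cmap T' T'' g1 g0"
  shows "cmap T T'' (g1 * f1) (g0 * f0)"
proof -
  obtain P Q d P' Q' d' P'' Q'' d'' where T: "T = (P, Q, d)" "T' = (P', Q', d')" "T'' = (P'', Q'', d'')"
    by (cases T; cases T'; cases T'')
  have "(g0 * f0) * d = (g0 * d') * f1" using assms(1) by (simp add: T mult.assoc)
  also have "\<dots> = d'' * (g1 * f1)" using assms(2) by (simp add: T mult.assoc)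
  finally show ?thesis using assms by (auto simp: T intro: Hom_comp)
qed

lemma cmap_add:
  assumes "cmap T T' f1 f0" "cmap T T' g1 g0"
  shows "cmap T T' (f1 + g1) (f0 + g0)"
  using assms by (cases T; cases T') (auto intro: Hom_add simp: algebra_simps)

lemma null_add:
  assumes "null T T' f1 f0" "null T T' g1 g0"
  shows "null T T' (f1 + g1) (f0 + g0)"
proof -
  obtain P Q d P' Q' d' where T: "T = (P, Q, d)" "T' = (P', Q', d')" by (cases T; cases T')
  obtain h k where "Hom Q P' h" "f0 = d' * h" "f1 = h * d" "Hom Q P' k" "g0 = d' * k" "g1 = k * d"
    using assms by (auto simp: T)
  then show ?thesis unfolding T by (auto intro!: exI[of _ "h + k"] Hom_add simp: algebra_simps)
qed

lemma null_post:
  assumes "null T T' f1 f0" "cmap T' T'' g1 g0"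
  shows "null T T'' (g1 * f1) (g0 * f0)"
proof -
  obtain P Q d P' Q' d' P'' Q'' d'' where T: "T = (P, Q, d)" "T' = (P', Q', d')" "T'' = (P'', Q'', d'')"
    by (cases T; cases T'; cases T'')
  then obtain h where "Hom Q P' h" "f0 = d' * h" "f1 = h * d" using assms by auto
  then show ?thesis using assms(2) unfolding T
    by (auto intro!: exI[of _ "g1 * h"] intro: Hom_comp simp: mult.assoc[symmetric])
qed

lemma null_pre:
  assumes "cmap U T g1 g0" "null T T' f1 f0"
  shows "null U T' (f1 * g1) (f0 * g0)"
proof -
  obtain P Q d P' Q' d' P'' Q'' d'' where T: "T = (P, Q, d)" "T' = (P', Q', d')" "U = (P'', Q'', d'')"
    by (cases T; cases T'; cases U)
  then obtain h where "Hom Q P' h" "f0 = d' * h" "f1 = h * d" using assms by auto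
  then show ?thesis using assms(1) unfolding T
    by (auto intro!: exI[of _ "h * g0"] intro: Hom_comp simp: mult.assoc)
qed

lemma null_zero: "null T T' 0 0"
  by (cases T; cases T') (auto intro!: exI[of _ 0] Hom_zero)

lemma null_uminus: "null T T' f1 f0 \<Longrightarrow> null T T' (- f1) (- f0)"
proof -
  assume n: "null T T' f1 f0"
  obtain P Q d P' Q' d' where T: "T = (P, Q, d)" "T' = (P', Q', d')" by (cases T; cases T')
  obtain h where "Hom Q P' h" "f0 = d' * h" "f1 = h * d" using n by (auto simp: T)
  then show ?thesis unfolding T by (auto intro!: exI[of _ "- h"] Hom_uminus)
qed

lemma heq_retract: "heq T T' \<Longrightarrow> retract T T'"
  by (cases T; cases T') (simp, blast)

lemma heq_sym: "heq T T' \<Longrightarrow> heq T' T"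
  by (cases T; cases T') (simp, blast)

text \<open>Writing id for the identities, g v u f - id = g (v u - id) f + (g f - id), a sum of two
  null-homotopic maps.\<close>

lemma null_comp_id:
  assumes T: "T = (P, Q, d)" and T': "T' = (P', Q', d')"
    and f: "cmap T T' f1 f0" and g: "cmap T' T g1 g0"
    and gf: "null T T (g1 * f1 - P) (g0 * f0 - Q)"
    and vu: "null T' T' (v1 * u1 - P') (v0 * u0 - Q')"
  shows "null T T ((g1 * v1) * (u1 * f1) - P) ((g0 * v0) * (u0 * f0) - Q)"
proof -
  have "null T T (g1 * ((v1 * u1 - P') * f1) + (g1 * f1 - P)) (g0 * ((v0 * u0 - Q') * f0) + (g0 * f0 - Q))"
    by (intro null_add gf null_post[OF null_pre[OF f vu] g])
  moreover have "P' * f1 = f1" "Q' * f0 = f0" using f by (auto simp: T T' Hom_def)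
  ultimately show ?thesis by (simp add: algebra_simps)
qed

lemma retract_trans:
  assumes "retract T T'" "retract T' T''"
  shows "retract T T''"
proof -
  obtain P Q d P' Q' d' P'' Q'' d'' where T: "T = (P, Q, d)" "T' = (P', Q', d')" "T'' = (P'', Q'', d'')"
    by (cases T; cases T'; cases T'')
  obtain f1 f0 g1 g0 where f: "cmap T T' f1 f0" "cmap T' T g1 g0"
     "null T T (g1 * f1 - P) (g0 * f0 - Q)"
    using assms(1) unfolding T heq.simps retract.simps by blast
  obtain u1 u0 v1 v0 where u: "cmap T' T'' u1 u0" "cmap T'' T' v1 v0"
     "null T' T' (v1 * u1 - P') (v0 * u0 - Q')"
    using assms(2) unfolding T heq.simps retract.simps by blast
  have "cmap T T'' (u1 * f1) (u0 * f0)" "cmap T'' T (g1 * v1) (g0 * v0)"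
    using f u by (auto intro: cmap_comp)
  moreover have "null T T ((g1 * v1) * (u1 * f1) - P) ((g0 * v0) * (u0 * f0) - Q)"
    by (rule null_comp_id[OF T(1,2) f(1-3) u(3)])
  ultimately show ?thesis unfolding T retract.simps by blast
qed

lemma heq_trans:
  assumes "heq T T'" "heq T' T''"
  shows "heq T T''"
proof -
  obtain P Q d P' Q' d' P'' Q'' d'' where T: "T = (P, Q, d)" "T' = (P', Q', d')" "T'' = (P'', Q'', d'')"
    by (cases T; cases T'; cases T'')
  obtain f1 f0 g1 g0 where f: "cmap T T' f1 f0" "cmap T' T g1 g0"
     "null T T (g1 * f1 - P) (g0 * f0 - Q)" "null T' T' (f1 * g1 - P') (f0 * g0 - Q')"
    using assms(1) unfolding T heq.simps retract.simps by blast
  obtain u1 u0 v1 v0 where u: "cmap T' T'' u1 u0" "cmap T'' T' v1 v0"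
     "null T' T' (v1 * u1 - P') (v0 * u0 - Q')" "null T'' T'' (u1 * v1 - P'') (u0 * v0 - Q'')"
    using assms(2) unfolding T heq.simps retract.simps by blast
  have "cmap T T'' (u1 * f1) (u0 * f0)" "cmap T'' T (g1 * v1) (g0 * v0)"
    using f u by (auto intro: cmap_comp)
  moreover have "null T T ((g1 * v1) * (u1 * f1) - P) ((g0 * v0) * (u0 * f0) - Q)"
    by (rule null_comp_id[OF T(1,2) f(1-3) u(3)])
  moreover have "null T'' T'' ((u1 * f1) * (g1 * v1) - P'') ((u0 * f0) * (g0 * v0) - Q'')"
    by (rule null_comp_id[OF T(3,2) u(2,1,4) f(4)])
  ultimately show ?thesis unfolding T heq.simps by blast
qed

lemma cmap_id: "obj (P, Q, d) \<Longrightarrow> cmap (P, Q, d) (P, Q, d) P Q"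
  by (auto simp: Hom_def)

lemma heq_refl: "obj T \<Longrightarrow> heq T T"
proof -
  assume T: "obj T"
  obtain P Q d where T': "T = (P, Q, d)" by (cases T)
  have "cmap T T P Q" using T cmap_id by (simp add: T')
  moreover have "null T T (P * P - P) (Q * Q - Q)" using T null_zero by (simp add: T' Hom_def)
  ultimately show ?thesis unfolding T' heq.simps by blast
qed

text \<open>The identity is g f - (g f - id), where g f factors through a contractible complex and
  the bracket is null-homotopic.\<close>

lemma contractible_retract:
  assumes "retract T T'" "contractible T'"
  shows "contractible T"
proof -
  obtain P Q d P' Q' d' where T: "T = (P, Q, d)" "T' = (P', Q', d')" by (cases T; cases T')
  obtain f1 f0 g1 g0 where f: "cmap T T' f1 f0" "cmap T' T g1 g0"
     "null T T (g1 * f1 - P) (g0 * f0 - Q)"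
    using assms(1) unfolding T retract.simps by blast
  have "null T' T' P' Q'" using assms(2) by (auto simp: T)
  then have "null T T (g1 * (P' * f1) + - (g1 * f1 - P)) (g0 * (Q' * f0) + - (g0 * f0 - Q))"
    by (intro null_add null_uminus f(3) null_post[OF null_pre[OF f(1)] f(2)])
  moreover have "P' * f1 = f1" "Q' * f0 = f0" using f(1) by (auto simp: T Hom_def)
  ultimately show ?thesis by (simp add: T)
qed

text \<open>Compose \<open>x\<close> with \<open>g1\<close>, split the result over \<open>T'\<close>
  and return along \<open>f1\<close>. Replacing \<open>g1 * f1\<close> by the identity costs
  \<open>x * h * d\<close>, which is absorbed into the coefficient of \<open>d\<close>.\<close>

lemma rigid_retract_left:
  assumes "retract T T'" "rigid T' X"
  shows "rigid T X"
proof -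
  obtain P Q d P' Q' d' R U c where T: "T = (P, Q, d)" "T' = (P', Q', d')" "X = (R, U, c)"
    by (cases T; cases T'; cases X)
  obtain f1 f0 g1 g0 h where f: "Hom P P' f1" "Hom Q Q' f0" "f0 * d = d' * f1"
     and g: "Hom P' P g1" "Hom Q' Q g0" "g0 * d' = d * g1"
     and h: "Hom Q P h" "g1 * f1 - P = h * d"
    using assms(1) unfolding T by auto
  show ?thesis unfolding T rigid.simps
  proof (intro allI impI)
    fix x assume x: "Hom P U x"
    then have "Hom P' U (x * g1)" using g Hom_comp by blast
    then obtain a b where ab: "Hom P' R a" "Hom Q' U b" "x * g1 = c * a + b * d'"
      using assms(2) unfolding T by auto
    have "x * (g1 * f1) = c * (a * f1) + (b * f0) * d"
      using ab(3) f(3) by (metis distrib_right mult.assoc)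
    moreover have "x * (g1 * f1) = x + (x * h) * d"
    proof -
      have "g1 * f1 = P + h * d" using h(2) by (simp add: algebra_simps)
      then show ?thesis using x by (simp add: Hom_def algebra_simps)
    qed
    ultimately have "x = c * (a * f1) + (b * f0 - x * h) * d"
      by (simp add: algebra_simps)
    moreover have "Hom P R (a * f1)" "Hom Q U (b * f0 - x * h)"
      using ab f h x by (auto intro: Hom_comp Hom_diff)
    ultimately show "\<exists>a b. Hom P R a \<and> Hom Q U b \<and> x = c * a + b * d" by blast
  qed
qed

lemma rigid_retract_right:
  assumes "retract T T'" "rigid X T'"
  shows "rigid X T"
proof -
  obtain P Q d P' Q' d' R U c where T: "T = (P, Q, d)" "T' = (P', Q', d')" "X = (R, U, c)"
    by (cases T; cases T'; cases X)
  obtain f1 f0 g1 g0 h where f: "Hom P P' f1" "Hom Q Q' f0" "f0 * d = d' * f1"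
     and g: "Hom P' P g1" "Hom Q' Q g0" "g0 * d' = d * g1"
     and h: "Hom Q P h" "g0 * f0 - Q = d * h"
    using assms(1) unfolding T by auto
  show ?thesis unfolding T rigid.simps
  proof (intro allI impI)
    fix x assume x: "Hom R Q x"
    then have "Hom R Q' (f0 * x)" using f Hom_comp by blast
    then obtain a b where ab: "Hom R P' a" "Hom U Q' b" "f0 * x = d' * a + b * c"
      using assms(2) unfolding T by auto
    have "(g0 * f0) * x = d * (g1 * a) + (g0 * b) * c"
      using ab(3) g(3) by (metis distrib_left mult.assoc)
    moreover have "(g0 * f0) * x = x + d * (h * x)"
    proof -
      have "g0 * f0 = Q + d * h" using h(2) by (simp add: algebra_simps)
      then show ?thesis using x by (simp add: Hom_def algebra_simps)
    qed
    ultimately have "x = d * (g1 * a - h * x) + (g0 * b) * c"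
      by (simp add: algebra_simps)
    moreover have "Hom R P (g1 * a - h * x)" "Hom U Q (g0 * b)"
      using ab g h x by (auto intro: Hom_comp Hom_diff)
    ultimately show "\<exists>a b. Hom R P a \<and> Hom U Q b \<and> x = d * a + b * c" by blast
  qed
qed

text \<open>The last four arguments of \<open>biprod\<close> are the inclusions and projections, each a pair of
  components in degrees -1 and 0.\<close>

fun biprod :: "'r cpx \<Rightarrow> 'r cpx \<Rightarrow> 'r cpx \<Rightarrow> 'r \<times> 'r \<Rightarrow> 'r \<times> 'r \<Rightarrow> 'r \<times> 'r \<Rightarrow> 'r \<times> 'r \<Rightarrow> bool" where
  "biprod (P, Q, d) (P1, Q1, d1) (P2, Q2, d2) (i1, j1) (i2, j2) (p1, q1) (p2, q2) \<longleftrightarrow>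
     cmap (P1, Q1, d1) (P, Q, d) i1 j1 \<and> cmap (P2, Q2, d2) (P, Q, d) i2 j2 \<and>
     cmap (P, Q, d) (P1, Q1, d1) p1 q1 \<and> cmap (P, Q, d) (P2, Q2, d2) p2 q2 \<and>
     p1 * i1 = P1 \<and> p2 * i2 = P2 \<and> p1 * i2 = 0 \<and> p2 * i1 = 0 \<and> i1 * p1 + i2 * p2 = P \<and>
     q1 * j1 = Q1 \<and> q2 * j2 = Q2 \<and> q1 * j2 = 0 \<and> q2 * j1 = 0 \<and> j1 * q1 + j2 * q2 = Q"

text \<open>Only the four blocks of \<open>d\<close> have to be known: inserting the decomposition
  of \<open>Q\<close> to the left of \<open>d\<close> and that of \<open>P\<close> to the right
  yields the chain map equations of all inclusions and projections.\<close>

lemma biprodI: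
  assumes d: "Hom P Q d"
    and P: "Hom P1 P i1" "Hom P2 P i2" "Hom P P1 p1" "Hom P P2 p2"
      "p1 * i1 = P1" "p2 * i2 = P2" "p1 * i2 = 0" "p2 * i1 = 0" "i1 * p1 + i2 * p2 = P"
    and Q: "Hom Q1 Q j1" "Hom Q2 Q j2" "Hom Q Q1 q1" "Hom Q Q2 q2"
      "q1 * j1 = Q1" "q2 * j2 = Q2" "q1 * j2 = 0" "q2 * j1 = 0" "j1 * q1 + j2 * q2 = Q"
    and D: "q1 * d * i1 = d1" "q2 * d * i2 = d2" "q1 * d * i2 = 0" "q2 * d * i1 = 0"
  shows "biprod (P, Q, d) (P1, Q1, d1) (P2, Q2, d2) (i1, j1) (i2, j2) (p1, q1) (p2, q2)"
proof -
  have col: "d * i = j1 * (q1 * d * i) + j2 * (q2 * d * i)" for i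
  proof -
    have "d * i = Q * d * i" using d by (simp add: Hom_def)
    also have "\<dots> = j1 * (q1 * d * i) + j2 * (q2 * d * i)"
      unfolding Q(9)[symmetric] by (simp add: distrib_right mult.assoc)
    finally show ?thesis .
  qed
  have row: "q * d = (q * d * i1) * p1 + (q * d * i2) * p2" for q
  proof -
    have "q * d = q * (d * P)" using d by (simp add: Hom_def)
    also have "\<dots> = (q * d * i1) * p1 + (q * d * i2) * p2"
      unfolding P(9)[symmetric] by (simp add: distrib_left mult.assoc)
    finally show ?thesis .
  qed
  have "d * i1 = j1 * d1" "d * i2 = j2 * d2" using col[of i1] col[of i2] D by simp_all
  moreover have "q1 * d = d1 * p1" "q2 * d = d2 * p2" using row[of q1] row[of q2] D by simp_all
  ultimately show ?thesis using P Q by simp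
qed

lemma biprod_retract:
  assumes "biprod T T1 T2 i j p q"
  shows "retract T1 T" "retract T2 T"
proof -
  obtain P Q d P1 Q1 d1 P2 Q2 d2 where T: "T = (P, Q, d)" "T1 = (P1, Q1, d1)" "T2 = (P2, Q2, d2)"
    by (cases T; cases T1; cases T2)
  obtain i1 j1 i2 j2 p1 q1 p2 q2 where I: "i = (i1, j1)" "j = (i2, j2)" "p = (p1, q1)" "q = (p2, q2)"
    by (cases i; cases j; cases p; cases q)
  note A = assms[unfolded T I biprod.simps]
  show "retract T1 T" unfolding T retract.simps
    by (rule exI[of _ i1], rule exI[of _ j1], rule exI[of _ p1], rule exI[of _ q1])
       (use A null_zero in auto)
  show "retract T2 T" unfolding T retract.simps
    by (rule exI[of _ i2], rule exI[of _ j2], rule exI[of _ p2], rule exI[of _ q2])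
       (use A null_zero in auto)
qed

lemma biprod_rigid_left:
  assumes "biprod T T1 T2 i j p q" "rigid T1 X" "rigid T2 X"
  shows "rigid T X"
proof -
  obtain P Q d P1 Q1 d1 P2 Q2 d2 where T: "T = (P, Q, d)" "T1 = (P1, Q1, d1)" "T2 = (P2, Q2, d2)"
    by (cases T; cases T1; cases T2)
  obtain i1 j1 i2 j2 p1 q1 p2 q2 where I: "i = (i1, j1)" "j = (i2, j2)" "p = (p1, q1)" "q = (p2, q2)"
    by (cases i; cases j; cases p; cases q)
  obtain R U c where X: "X = (R, U, c)" by (cases X)
  note A = assms(1)[unfolded T I biprod.simps cmap.simps]
  show ?thesis unfolding T X rigid.simps
  proof (intro allI impI)
    fix x assume x: "Hom P U x"
    have "Hom P1 U (x * i1)" "Hom P2 U (x * i2)" using A x Hom_comp by blast+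
    then obtain a b a' b' where ab: "Hom P1 R a" "Hom Q1 U b" "x * i1 = c * a + b * d1"
      "Hom P2 R a'" "Hom Q2 U b'" "x * i2 = c * a' + b' * d2"
      using assms(2,3) unfolding T X rigid.simps by metis
    have "x = x * (i1 * p1 + i2 * p2)" using A x by (simp add: Hom_def)
    also have "\<dots> = (x * i1) * p1 + (x * i2) * p2" by (simp add: algebra_simps)
    also have "\<dots> = c * (a * p1 + a' * p2) + (b * (d1 * p1) + b' * (d2 * p2))"
      unfolding ab by (simp add: algebra_simps)
    also have "\<dots> = c * (a * p1 + a' * p2) + (b * (q1 * d) + b' * (q2 * d))"
      using A by metis
    finally have "x = c * (a * p1 + a' * p2) + (b * q1 + b' * q2) * d"
      by (simp add: algebra_simps)
    moreover have "Hom P R (a * p1 + a' * p2)" "Hom Q U (b * q1 + b' * q2)"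
      using A ab Hom_comp Hom_add by meson+
    ultimately show "\<exists>a b. Hom P R a \<and> Hom Q U b \<and> x = c * a + b * d" by blast
  qed
qed

lemma biprod_rigid_right:
  assumes "biprod T T1 T2 i j p q" "rigid X T1" "rigid X T2"
  shows "rigid X T"
proof -
  obtain P Q d P1 Q1 d1 P2 Q2 d2 where T: "T = (P, Q, d)" "T1 = (P1, Q1, d1)" "T2 = (P2, Q2, d2)"
    by (cases T; cases T1; cases T2)
  obtain i1 j1 i2 j2 p1 q1 p2 q2 where I: "i = (i1, j1)" "j = (i2, j2)" "p = (p1, q1)" "q = (p2, q2)"
    by (cases i; cases j; cases p; cases q)
  obtain R U c where X: "X = (R, U, c)" by (cases X)
  note A = assms(1)[unfolded T I biprod.simps cmap.simps]
  show ?thesis unfolding T X rigid.simps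
  proof (intro allI impI)
    fix x assume x: "Hom R Q x"
    have "Hom R Q1 (q1 * x)" "Hom R Q2 (q2 * x)" using A x Hom_comp by blast+
    then obtain a b a' b' where ab: "Hom R P1 a" "Hom U Q1 b" "q1 * x = d1 * a + b * c"
      "Hom R P2 a'" "Hom U Q2 b'" "q2 * x = d2 * a' + b' * c"
      using assms(2,3) unfolding T X rigid.simps by metis
    have "x = (j1 * q1 + j2 * q2) * x" using A x by (simp add: Hom_def)
    also have "\<dots> = j1 * (q1 * x) + j2 * (q2 * x)" by (simp add: algebra_simps)
    also have "\<dots> = ((j1 * d1) * a + (j2 * d2) * a') + (j1 * b + j2 * b') * c"
      unfolding ab by (simp add: algebra_simps)
    also have "\<dots> = ((d * i1) * a + (d * i2) * a') + (j1 * b + j2 * b') * c"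
      using A by metis
    finally have "x = d * (i1 * a + i2 * a') + (j1 * b + j2 * b') * c"
      by (simp add: algebra_simps)
    moreover have "Hom R P (i1 * a + i2 * a')" "Hom U Q (j1 * b + j2 * b')"
      using A ab Hom_comp Hom_add by meson+
    ultimately show "\<exists>a b. Hom R P a \<and> Hom U Q b \<and> x = d * a + b * c" by blast
  qed
qed

text \<open>One degree of the composite of two block diagonal maps; orthogonality kills the cross
  terms. It serves both degrees and both orders of composition in \<open>heq_biprod\<close>.\<close>

lemma biprod_comp_id:
  fixes i1 :: 'r
  assumes "p1' * i1' = P1'" "p2' * i2' = P2'" "p1' * i2' = 0" "p2' * i1' = 0"
    and "P1' * f = f" "P2' * f' = f'" "i1 * P1 = i1" "i2 * P2 = i2"
  shows "(i1 * (g * p1') + i2 * (g' * p2')) * (i1' * (f * p1) + i2' * (f' * p2)) - (i1 * p1 + i2 * p2)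
     = i1 * ((g * f - P1) * p1) + i2 * ((g' * f' - P2) * p2)"
proof -
  have r: "p1' * (i1' * x) = P1' * x" "p2' * (i2' * x) = P2' * x" "p1' * (i2' * x) = 0" "p2' * (i1' * x) = 0"
    "P1' * (f * x) = f * x" "P2' * (f' * x) = f' * x" "i1 * (P1 * x) = i1 * x" "i2 * (P2 * x) = i2 * x" for x
    using assms by (simp_all add: mult.assoc[symmetric])
  show ?thesis by (simp add: algebra_simps r)
qed

lemma heq_biprod:
  assumes "heq T1 T1'" "heq T2 T2'"
    and "biprod T T1 T2 i j p q" "biprod T' T1' T2' i' j' p' q'"
  shows "heq T T'"
proof -
  obtain P Q d P1 Q1 d1 P2 Q2 d2 where T: "T = (P, Q, d)" "T1 = (P1, Q1, d1)" "T2 = (P2, Q2, d2)"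
    by (cases T; cases T1; cases T2)
  obtain P' Q' d' P1' Q1' d1' P2' Q2' d2' where
    T': "T' = (P', Q', d')" "T1' = (P1', Q1', d1')" "T2' = (P2', Q2', d2')"
    by (cases T'; cases T1'; cases T2')
  obtain i1 j1 i2 j2 p1 q1 p2 q2 where I: "i = (i1, j1)" "j = (i2, j2)" "p = (p1, q1)" "q = (p2, q2)"
    by (cases i; cases j; cases p; cases q)
  obtain i1' j1' i2' j2' p1' q1' p2' q2' where
    I': "i' = (i1', j1')" "j' = (i2', j2')" "p' = (p1', q1')" "q' = (p2', q2')"
    by (cases i'; cases j'; cases p'; cases q')
  note A = assms(3)[unfolded T I biprod.simps, folded T]
  note A' = assms(4)[unfolded T' I' biprod.simps, folded T']
  obtain f1 f0 g1 g0 where f: "cmap T1 T1' f1 f0" "cmap T1' T1 g1 g0"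
     "null T1 T1 (g1 * f1 - P1) (g0 * f0 - Q1)" "null T1' T1' (f1 * g1 - P1') (f0 * g0 - Q1')"
    using assms(1) unfolding T T' heq.simps by blast
  obtain u1 u0 v1 v0 where u: "cmap T2 T2' u1 u0" "cmap T2' T2 v1 v0"
     "null T2 T2 (v1 * u1 - P2) (v0 * u0 - Q2)" "null T2' T2' (u1 * v1 - P2') (u0 * v0 - Q2')"
    using assms(2) unfolding T T' heq.simps by blast
  let ?F1 = "i1' * (f1 * p1) + i2' * (u1 * p2)" and ?F0 = "j1' * (f0 * q1) + j2' * (u0 * q2)"
  let ?G1 = "i1 * (g1 * p1') + i2 * (v1 * p2')" and ?G0 = "j1 * (g0 * q1') + j2 * (v0 * q2')"
  have "cmap T T' ?F1 ?F0" "cmap T' T ?G1 ?G0"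
    using A A' f u by (auto intro!: cmap_add intro: cmap_comp)
  moreover have "null T T (?G1 * ?F1 - P) (?G0 * ?F0 - Q)"
  proof -
    have "null T T (i1 * ((g1 * f1 - P1) * p1) + i2 * ((v1 * u1 - P2) * p2))
        (j1 * ((g0 * f0 - Q1) * q1) + j2 * ((v0 * u0 - Q2) * q2))"
      using A f u by (auto intro!: null_add intro: null_post null_pre)
    moreover have "?G1 * ?F1 - (i1 * p1 + i2 * p2) = i1 * ((g1 * f1 - P1) * p1) + i2 * ((v1 * u1 - P2) * p2)"
      by (rule biprod_comp_id[of _ _ P1' _ _ P2']) (use A A' f u in \<open>auto simp: T T' Hom_def\<close>)
    moreover have "?G0 * ?F0 - (j1 * q1 + j2 * q2) = j1 * ((g0 * f0 - Q1) * q1) + j2 * ((v0 * u0 - Q2) * q2)"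
      by (rule biprod_comp_id[of _ _ Q1' _ _ Q2']) (use A A' f u in \<open>auto simp: T T' Hom_def\<close>)
    ultimately show ?thesis using A by (metis)
  qed
  moreover have "null T' T' (?F1 * ?G1 - P') (?F0 * ?G0 - Q')"
  proof -
    have "null T' T' (i1' * ((f1 * g1 - P1') * p1') + i2' * ((u1 * v1 - P2') * p2'))
        (j1' * ((f0 * g0 - Q1') * q1') + j2' * ((u0 * v0 - Q2') * q2'))"
      using A' f u by (auto intro!: null_add intro: null_post null_pre)
    moreover have "?F1 * ?G1 - (i1' * p1' + i2' * p2') = i1' * ((f1 * g1 - P1') * p1') + i2' * ((u1 * v1 - P2') * p2')"
      by (rule biprod_comp_id[of _ _ P1 _ _ P2]) (use A A' f u in \<open>auto simp: T T' Hom_def\<close>)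
    moreover have "?F0 * ?G0 - (j1' * q1' + j2' * q2') = j1' * ((f0 * g0 - Q1') * q1') + j2' * ((u0 * v0 - Q2') * q2')"
      by (rule biprod_comp_id[of _ _ Q1 _ _ Q2]) (use A A' f u in \<open>auto simp: T T' Hom_def\<close>)
    ultimately show ?thesis using A' by (metis)
  qed
  ultimately show ?thesis unfolding T T' heq.simps by blast
qed

text \<open>Gaussian elimination of an invertible entry \<open>v\<^sup>-\<^sup>1\<close> of the differential: \<open>Ep\<close> and \<open>Eq\<close> are the
  idempotents of the two cancelled summands, \<open>P'\<close> and \<open>Q'\<close> the complements.\<close>

lemma heq_cancel:
  assumes T: "obj (P, Q, d)"
    and i: "Hom P' P i" "Hom P P' p" "p * i = P'" "i * p = P - Ep"
    and j: "Hom Q' Q j" "Hom Q Q' q" "q * j = Q'" "j * q = Q - Eq"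
    and v: "Hom Q P v" "Ep * v = v" "v * Eq = v" "v * d * Ep = Ep" "Eq * d * v = Eq"
    and E: "P * Ep = Ep" "Ep * P = Ep" "Q * Eq = Eq" "Eq * Q = Eq"
  shows "heq (P, Q, d) (P', Q', q * (d - d * v * d) * i)"
    and "Hom P' Q' (q * (d - d * v * d) * i)"
proof -
  \<comment> \<open>A Schur complement: subtracting \<open>d * v * d\<close> clears the column of
    \<open>Ep\<close> and the row of \<open>Eq\<close> (facts \<open>dE\<close> and
    \<open>Ed\<close> below). The homotopy contracting the cancelled part will be
    \<open>- v\<close>.\<close>
  let ?d = "q * (d - d * v * d) * i"
  note H = T[simplified, unfolded Hom_def] i(1,2)[unfolded Hom_def] j(1,2)[unfolded Hom_def] v(1)[unfolded Hom_def]
  have Hd: "Hom P Q d" "Hom P P P" "Hom Q Q Q" using T by auto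
  have pv: "p * v = 0"
  proof -
    have "p * (i * p) = p" using i(2,3) by (metis Hom_def mult.assoc)
    then have "p * Ep = 0" using i(2,4) by (simp add: Hom_def algebra_simps)
    then show ?thesis by (metis v(2) mult.assoc mult_zero_left)
  qed
  have vj: "v * j = 0"
  proof -
    have "(j * q) * j = j" using j(1,3) by (metis Hom_def mult.assoc)
    then have "Eq * j = 0" using j(1,4) by (simp add: Hom_def algebra_simps)
    then show ?thesis by (metis v(3) mult.assoc mult_zero_right)
  qed
  have dd: "Hom P Q (d - d * v * d)" using Hd v(1) by (meson Hom_comp Hom_diff)
  show "Hom P' Q' ?d" using dd i j by (meson Hom_comp)
  have dE: "(d - d * v * d) * Ep = 0"
    using v(4) by (simp add: algebra_simps)
  have Ed: "Eq * (d - d * v * d) = 0"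
  proof -
    have "Eq * (d * v * d) = (Eq * d * v) * d" by (simp add: mult.assoc)
    then show ?thesis unfolding v(5) by (simp add: right_diff_distrib)
  qed
  have "cmap (P, Q, d) (P', Q', ?d) p (q * (Q - d * v))"
  proof -
    have "q * (Q - d * v) * d = q * (d - d * v * d)" using H by (simp add: algebra_simps)
    moreover have "?d * p = q * ((d - d * v * d) * (P - Ep))"
      unfolding i(4)[symmetric] by (simp add: mult.assoc)
    moreover have "(d - d * v * d) * (P - Ep) = d - d * v * d"
      using dE dd by (simp add: Hom_def right_diff_distrib)
    moreover have "Hom Q Q' (q * (Q - d * v))" using Hd v(1) j by (meson Hom_comp Hom_diff)
    ultimately show ?thesis using i by simp
  qed
  moreover have "cmap (P', Q', ?d) (P, Q, d) ((P - v * d) * i) j"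
  proof -
    have "d * ((P - v * d) * i) = (d - d * v * d) * i" using H by (simp add: algebra_simps)
    moreover have "j * ?d = (Q - Eq) * (d - d * v * d) * i"
      unfolding j(4)[symmetric] by (simp add: mult.assoc)
    moreover have "(Q - Eq) * (d - d * v * d) = d - d * v * d"
      using Ed dd by (simp add: Hom_def left_diff_distrib)
    moreover have "Hom P' P ((P - v * d) * i)" using Hd v(1) i by (meson Hom_comp Hom_diff)
    ultimately show ?thesis using j by simp
  qed
  moreover have "null (P, Q, d) (P, Q, d) ((P - v * d) * i * p - P) (j * (q * (Q - d * v)) - Q)"
  proof -
    have "(P - v * d) * i * p = (P - v * d) * (P - Ep)" by (simp add: mult.assoc i(4))
    also have "\<dots> = P - v * d" using H E v(4) by (simp add: algebra_simps)
    finally have 1: "(P - v * d) * i * p - P = - v * d" by simp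
    have "j * (q * (Q - d * v)) = (Q - Eq) * (Q - d * v)" by (simp add: mult.assoc[symmetric] j(4))
    also have "\<dots> = Q * Q - Eq * Q - Q * d * v + Eq * d * v" by (simp add: algebra_simps)
    also have "\<dots> = Q - d * v" unfolding v(5) using H E by simp
    finally have 2: "j * (q * (Q - d * v)) - Q = d * - v" by simp
    show ?thesis unfolding 1 2 null.simps using v(1) Hom_uminus by blast
  qed
  moreover have "null (P', Q', ?d) (P', Q', ?d) (p * ((P - v * d) * i) - P') (q * (Q - d * v) * j - Q')"
  proof -
    have "p * ((P - v * d) * i) = p * P * i - (p * v) * (d * i)" by (simp add: algebra_simps)
    also have "\<dots> = P'" using H i pv by simp
    finally have 1: "p * ((P - v * d) * i) - P' = 0" by simp
    have "q * (Q - d * v) * j = q * Q * j - q * d * (v * j)" by (simp add: algebra_simps)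
    also have "\<dots> = Q'" using H j vj by simp
    finally have 2: "q * (Q - d * v) * j - Q' = 0" by simp
    show ?thesis unfolding 1 2 by (rule null_zero)
  qed
  ultimately show "heq (P, Q, d) (P', Q', ?d)" unfolding heq.simps by blast
qed

end

section \<open>Primitive idempotents and the radical\<close>

text \<open>For \<open>x\<close> in the corner \<open>u A u\<close> this is invertibility in that
  ring, whose unit is \<open>u\<close>.\<close>

definition unit_in :: "'a::ring_1 \<Rightarrow> 'a \<Rightarrow> bool" where
  "unit_in u x \<longleftrightarrow> (\<exists>y. u * y = y \<and> y * u = y \<and> x * y = u \<and> y * x = u)"

text \<open>By finite dimension the powers of \<open>x\<close> satisfy a linear relation. Dividing
  by its lowest nonzero coefficient expresses that power through higher ones; \<open>q\<close> is a
  polynomial in \<open>x\<close> and so commutes with \<open>x\<close>.\<close>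

lemma ex_power_absorb:
  fixes scale :: "'k::field \<Rightarrow> 'a::ring_1 \<Rightarrow> 'a" and x :: 'a
  assumes alg: "k_algebra scale" and fin: "finite_dimensional_alg scale"
  obtains k q where "x ^ k = x ^ Suc k * q" "x * q = q * x"
proof -
  interpret vector_space scale
    using alg unfolding k_algebra_def by unfold_locales auto
  have scale_left: "scale c (a * b) = scale c a * b" and scale_right: "scale c (a * b) = a * scale c b" for c a b
    using alg unfolding k_algebra_def by metis+
  show thesis
  \<comment> \<open>Linear dependence is a property of the set of powers and gives a relation
    between exponents only if the powers are distinct. A repeated power is already a relation of the
    required form.\<close>
  proof (cases "inj (\<lambda>k::nat. x ^ k)")
    case False
    then obtain i j :: nat where ij: "i < j" "x ^ i = x ^ j"
      unfolding inj_on_def by (metis linorder_neqE_nat)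
    have "x ^ j = x ^ Suc i * x ^ (j - Suc i)"
      unfolding power_add[symmetric] using ij(1) by simp
    with ij(2) have "x ^ i = x ^ Suc i * x ^ (j - Suc i)" by (rule trans)
    then show thesis by (rule that) (rule power_commutes[symmetric])
  next
    case True
    obtain B where B: "finite B" "\<And>y. \<exists>c. y = (\<Sum>b\<in>B. scale (c b) b)"
      using fin unfolding finite_dimensional_alg_def by blast
    have "y \<in> span B" for y
    proof -
      obtain c where c: "y = (\<Sum>b\<in>B. scale (c b) b)" using B(2) by blast
      show ?thesis unfolding c by (intro span_sum span_scale span_base)
    qed
    then have "range (\<lambda>k::nat. x ^ k) \<subseteq> span B" by blast
    moreover have "infinite (range (\<lambda>k::nat. x ^ k))" using True by (simp add: finite_image_iff)
    ultimately have "dependent (range (\<lambda>k::nat. x ^ k))"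
      using independent_span_bound[OF B(1)] by blast
    then obtain t u where t: "finite t" "t \<subseteq> range (\<lambda>k::nat. x ^ k)" "(\<Sum>v\<in>t. scale (u v) v) = 0"
      "\<exists>v\<in>t. u v \<noteq> 0"
      unfolding dependent_explicit by blast
    define K where "K = {k. x ^ k \<in> t \<and> u (x ^ k) \<noteq> 0}"
    have finK: "finite K"
      using finite_vimageI[OF t(1) True] by (rule finite_subset[rotated]) (auto simp: K_def)
    have neK: "K \<noteq> {}" using t(2,4) by (auto simp: K_def)
    define k where "k = Min K"
    define c where "c = u (x ^ k)"
    have k: "k \<in> K" "\<And>i. i \<in> K \<Longrightarrow> k \<le> i" using finK neK by (auto simp: k_def)
    have c: "c \<noteq> 0" using k by (auto simp: K_def c_def)
    have "(\<Sum>v\<in>t. scale (u v) v) = (\<Sum>v\<in>(\<lambda>k. x ^ k) ` K. scale (u v) v)"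
      by (rule sum.mono_neutral_right) (use t K_def in auto)
    also have "\<dots> = (\<Sum>i\<in>K. scale (u (x ^ i)) (x ^ i))"
      by (subst sum.reindex) (use True in \<open>auto intro: inj_on_subset\<close>)
    also have "\<dots> = scale c (x ^ k) + (\<Sum>i\<in>K - {k}. scale (u (x ^ i)) (x ^ i))"
      using finK k by (simp add: sum.remove c_def)
    finally have *: "scale c (x ^ k) = - (\<Sum>i\<in>K - {k}. scale (u (x ^ i)) (x ^ i))"
      using t(3) by (simp add: eq_neg_iff_add_eq_0)
    define q where "q = (\<Sum>i\<in>K - {k}. scale (- (u (x ^ i) / c)) (x ^ (i - Suc k)))"
    have "x ^ k = scale (1 / c) (scale c (x ^ k))" using c by simp
    also have "\<dots> = (\<Sum>i\<in>K - {k}. scale (- (u (x ^ i) / c)) (x ^ i))"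
      unfolding * by (simp add: scale_sum_right sum_negf del: scale_scale) (simp add: sum_negf)
    also have "\<dots> = (\<Sum>i\<in>K - {k}. x ^ Suc k * scale (- (u (x ^ i) / c)) (x ^ (i - Suc k)))"
    proof (rule sum.cong)
      fix i assume i: "i \<in> K - {k}"
      then have "Suc k \<le> i" using k(2)[of i] by auto
      then have "x ^ i = x ^ Suc k * x ^ (i - Suc k)" by (metis le_add_diff_inverse power_add)
      then show "scale (- (u (x ^ i) / c)) (x ^ i) = x ^ Suc k * scale (- (u (x ^ i) / c)) (x ^ (i - Suc k))"
        using scale_right by metis
    qed simp
    finally have "x ^ k = x ^ Suc k * q" by (simp add: q_def sum_distrib_left)
    moreover have "x * q = q * x"
      unfolding q_def sum_distrib_left sum_distrib_right
      by (rule sum.cong) (simp_all only: scale_left[symmetric] scale_right[symmetric] power_commutes)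
    ultimately show thesis by (rule that)
  qed
qed

lemma primitive_idem_corner:
  assumes "primitive_idem u" "f * f = f" "u * f = f" "f * u = f"
  shows "f = 0 \<or> f = u"
proof -
  have "(u - f) * (u - f) = u - f" "f * (u - f) = 0" "(u - f) * f = 0" "u = f + (u - f)"
    using assms by (auto simp: primitive_idem_def algebra_simps)
  then have "f = 0 \<or> u - f = 0"
    using assms(1,2) unfolding primitive_idem_def by blast
  then show ?thesis by auto
qed

text \<open>Fitting's lemma: some power of \<open>x\<close> is a multiple of an idempotent polynomial in \<open>x\<close>.\<close>

lemma primitive_idem_local:
  fixes scale :: "'k::field \<Rightarrow> 'a::ring_1 \<Rightarrow> 'a" and u x :: 'a
  assumes alg: "k_algebra scale" and fin: "finite_dimensional_alg scale"
    and u: "primitive_idem u" and x: "u * x = x" "x * u = x"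
  shows "unit_in u x \<or> unit_in u (u - x)"
proof -
  have uu: "u * u = u" using u by (simp add: primitive_idem_def)
  obtain l q where lq: "x ^ l = x ^ Suc l * q" "x * q = q * x"
    by (rule ex_power_absorb[OF alg fin, of x]) blast
  \<comment> \<open>The shift makes the exponent positive, so that \<open>x ^ k\<close> lies in the
    corner of \<open>u\<close>; the power with exponent 0 is the unit of the whole ring.\<close>
  define k where "k = Suc l"
  have k: "x ^ k = x ^ k * (x * q)"
  proof -
    have "x ^ k = x * x ^ l" by (simp add: k_def)
    also have "\<dots> = x * (x ^ Suc l * q)" by (subst lq(1)) simp
    also have "\<dots> = (x * x ^ k) * q" by (simp add: k_def mult.assoc)
    also have "x * x ^ k = x ^ k * x" by (rule power_commutes[symmetric])
    finally show ?thesis by (simp add: mult.assoc)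
  qed
  \<comment> \<open>Iterating \<open>k\<close> gives \<open>x ^ k = x ^ k * (x ^ m * q ^ m)\<close>
    for all \<open>m\<close>. Hence \<open>f\<close> acts as identity on \<open>x ^ k\<close> and is
    idempotent; as \<open>u\<close> is primitive, \<open>f\<close> is 0 or \<open>u\<close>.\<close>
  define f where "f = x ^ k * q ^ k"
  have kf: "x ^ k = x ^ k * (x ^ m * q ^ m)" for m
  proof (induction m)
    case (Suc m)
    have "x ^ k * (x ^ Suc m * q ^ Suc m) = (x ^ k * x ^ m) * (x * q) * q ^ m"
      by (simp only: power_Suc2[of x] power_Suc[of q] mult.assoc)
    also have "x ^ k * x ^ m = x ^ m * x ^ k" by (simp add: power_add[symmetric] add.commute)
    also have "x ^ m * x ^ k * (x * q) * q ^ m = x ^ m * (x ^ k * (x * q)) * q ^ m"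
      by (simp only: mult.assoc)
    also have "\<dots> = (x ^ m * x ^ k) * q ^ m" by (simp only: k[symmetric])
    also have "x ^ m * x ^ k = x ^ k * x ^ m" by (simp add: power_add[symmetric] add.commute)
    finally show ?case by (simp only: Suc[symmetric] mult.assoc)
  qed simp
  have f: "f = x ^ k * q ^ k" by (fact f_def)
  have f': "f = q ^ k * x ^ k"
    unfolding f_def using lq(2) by (metis power_commuting_commutes)
  have ff: "f * f = f"
  proof -
    have "f * f = q ^ k * (x ^ k * f)" by (simp add: f' mult.assoc)
    also have "x ^ k * f = x ^ k" using kf[of k] by (simp add: f_def)
    finally show ?thesis by (simp add: f')
  qed
  have ux: "u * x ^ k = x ^ k" "x ^ k * u = x ^ k"
    using x by (simp_all add: k_def mult.assoc[symmetric]) (simp add: power_commutes[symmetric] mult.assoc x del: power_Suc)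
  have uf: "u * f = f" "f * u = f"
    using ux by (simp_all add: f mult.assoc[symmetric]) (simp add: f[symmetric] f' mult.assoc ux)
  consider "f = 0" | "f = u" using primitive_idem_corner[OF u ff uf] by blast
  then show ?thesis
  proof cases
    case 1
    then have nil: "x ^ k = 0" using kf[of k] by (simp add: f_def)
    \<comment> \<open>\<open>x\<close> is nilpotent, and the geometric series, cut down to the
      corner by \<open>u\<close>, inverts \<open>u - x\<close>.\<close>
    define y where "y = (\<Sum>j<k. x ^ j)"
    have yx: "y * x = x * y" unfolding y_def
      by (simp add: sum_distrib_left sum_distrib_right power_commutes)
    have y: "y = 1 + x * y"
    proof -
      have "x * y = (\<Sum>j<k. x ^ Suc j)" by (simp add: y_def sum_distrib_left)
      then have "1 + x * y = (\<Sum>j<Suc k. x ^ j)" by (simp only: sum.lessThan_Suc_shift) simp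
      then show ?thesis by (simp add: y_def nil)
    qed
    have uy: "u * y = y * u"
    proof -
      have "u * x ^ j = x ^ j * u" for j
        using x by (intro power_commuting_commutes[symmetric]) simp
      then show ?thesis by (simp add: y_def sum_distrib_left sum_distrib_right)
    qed
    have "(u - x) * (u * y) = u * y - x * y" using uu x by (simp add: algebra_simps mult.assoc[symmetric])
    moreover have uxy: "u * y = u + x * y" using y x by (metis distrib_left mult.assoc mult.right_neutral)
    ultimately have 1: "(u - x) * (u * y) = u" by simp
    have "(u * y) * (u - x) = u * y - y * x" using uu x uy
      by (metis (no_types, lifting) mult.assoc right_diff_distrib yx)
    then have 2: "(u * y) * (u - x) = u" using uxy yx by simp
    have "u * (u * y) = u * y" "(u * y) * u = u * y" using uu uy by (metis mult.assoc)+
    then show ?thesis using 1 2 unfolding unit_in_def by blast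
  next
    case 2
    \<comment> \<open>Now \<open>x * (x ^ l * q ^ k) = f = u\<close>, so this cofactor, compressed
      to the corner, inverts \<open>x\<close>.\<close>
    define y where "y = u * (x ^ l * q ^ k) * u"
    have "x * y = x * (x ^ l * q ^ k) * u" by (simp add: y_def mult.assoc[symmetric] x)
    also have "x * (x ^ l * q ^ k) = f" by (simp add: f k_def mult.assoc)
    finally have 1: "x * y = u" by (simp add: 2 uu)
    have comm: "q ^ k * x = x * q ^ k" using lq(2) by (intro power_commuting_commutes) simp
    have "y * x = u * (x ^ l * (q ^ k * x))" by (simp add: y_def mult.assoc x)
    also have "x ^ l * (q ^ k * x) = (x ^ l * x) * q ^ k" by (simp only: comm mult.assoc)
    also have "(x ^ l * x) * q ^ k = f" by (simp only: f k_def power_Suc2)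
    finally have "y * x = u" by (simp add: 2 uu)
    moreover have "u * y = y" "y * u = y" by (simp_all add: y_def mult.assoc uu) (simp add: mult.assoc[symmetric] uu)
    ultimately show ?thesis using 1 unfolding unit_in_def by blast
  qed
qed

text \<open>\<open>loc\<close> says that the corners e_i A e_i are local rings. This is the form in
  which finite dimension is used from here on.\<close>

locale basic_idems =
  fixes n :: nat and e :: "nat \<Rightarrow> 'a::ring_1"
  assumes prim: "i < n \<Longrightarrow> primitive_idem (e i)"
    and loc: "i < n \<Longrightarrow> e i * x = x \<Longrightarrow> x * e i = x \<Longrightarrow> unit_in (e i) x \<or> unit_in (e i) (e i - x)"
    and basic: "basic_alg n e"
begin

lemma idem: "i < n \<Longrightarrow> e i * e i = e i"
  using prim by (simp add: primitive_idem_def)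

lemma nonzero: "i < n \<Longrightarrow> e i \<noteq> 0"
  using prim by (simp add: primitive_idem_def)

text \<open>\<open>b * a\<close> is a nonzero idempotent in the corner of the primitive
  \<open>e i\<close>, hence equal to \<open>e i\<close>. So e_i A and e_k A are isomorphic, and
  \<open>basic\<close> forces the indices to agree.\<close>

lemma split_epi_iso:
  assumes "k < n" "i < n" "e k * a = a" "a * e i = a" "e i * b = b" "b * e k = b" "a * b = e k"
  shows "i = k" "b * a = e i"
proof -
  have "(b * a) * (b * a) = b * (a * b) * a" by (simp add: mult.assoc)
  then have 1: "(b * a) * (b * a) = b * a" using assms by (simp add: mult.assoc)
  have 2: "e i * (b * a) = b * a" "(b * a) * e i = b * a" using assms by (simp_all add: mult.assoc[symmetric])
     (simp add: mult.assoc)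
  have "b * a \<noteq> 0"
  proof
    assume "b * a = 0"
    then have "(a * b) * (a * b) = 0" by (metis mult.assoc mult_zero_left mult_zero_right)
    then show False using assms idem nonzero by simp
  qed
  then show ba: "b * a = e i" using primitive_idem_corner[OF prim 1 2] assms by blast
  show "i = k"
  proof (rule ccontr)
    assume "i \<noteq> k"
    moreover have "a = e k * a * e i" "b = e i * b * e k" using assms by (simp_all add: mult.assoc)
    ultimately show False using basic assms ba unfolding basic_alg_def by blast
  qed
qed

text \<open>The Jacobson radical of the algebra, described so that it is visibly closed under
  multiplication from both sides.\<close>

definition rad :: "'a set" where
  "rad = {x. \<forall>i<n. \<forall>y z. \<not> unit_in (e i) (e i * y * x * z * e i)}"

lemma rad_mult_left: "x \<in> rad \<Longrightarrow> a * x \<in> rad"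
  unfolding rad_def by (simp add: mult.assoc) (metis mult.assoc)

lemma rad_mult_right: "x \<in> rad \<Longrightarrow> x * a \<in> rad"
  unfolding rad_def by (simp add: mult.assoc) (metis mult.assoc)

lemma not_unit_in_zero: "i < n \<Longrightarrow> \<not> unit_in (e i) 0"
  using nonzero by (auto simp: unit_in_def)

lemma rad_zero: "0 \<in> rad"
  by (simp add: rad_def not_unit_in_zero)

lemma rad_uminus: "x \<in> rad \<Longrightarrow> - x \<in> rad"
  using rad_mult_left[of x "-1"] by simp

text \<open>This is where locality is needed: multiplying by the inverse \<open>w\<close> gives two
  corner elements with sum \<open>e i\<close>, and one of them must be invertible.\<close>

lemma rad_add:
  assumes "x \<in> rad" "y \<in> rad"
  shows "x + y \<in> rad"
proof (rule ccontr)
  assume "x + y \<notin> rad"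
  then obtain i a b where i: "i < n" and u: "unit_in (e i) (e i * a * (x + y) * b * e i)"
    unfolding rad_def by blast
  then obtain w where w: "e i * w = w" "w * e i = w" "w * (e i * a * (x + y) * b * e i) = e i"
    unfolding unit_in_def by blast
  let ?X = "e i * (w * a) * x * b * e i" and ?Y = "e i * (w * a) * y * b * e i"
  have "?X + ?Y = (e i * w) * a * (x + y) * b * e i"
    by (simp add: algebra_simps)
  also have "\<dots> = e i" using w by (simp add: mult.assoc[symmetric])
  finally have XY: "e i - ?X = ?Y" by (simp add: algebra_simps)
  have "e i * ?X = ?X" "?X * e i = ?X" using idem[OF i] by (simp_all add: mult.assoc[symmetric])
     (simp add: mult.assoc)
  then have "unit_in (e i) ?X \<or> unit_in (e i) ?Y" using loc[OF i, of ?X] XY by simp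
  then show False using assms i unfolding rad_def by blast
qed

lemma rad_diff: "x \<in> rad \<Longrightarrow> y \<in> rad \<Longrightarrow> x - y \<in> rad"
  using rad_add[of x "- y"] rad_uminus by simp

lemma rad_sum: "(\<And>i. i \<in> I \<Longrightarrow> f i \<in> rad) \<Longrightarrow> sum f I \<in> rad"
  by (induction I rule: infinite_finite_induct) (auto intro: rad_zero rad_add)

text \<open>If \<open>x\<close> is not radical, some \<open>e k\<close> factors through
  \<open>x\<close>, hence through both \<open>e i\<close> and \<open>e j\<close>;
  \<open>split_epi_iso\<close> then identifies all three indices. Consequently maps between
  different e_i A are radical.\<close>

lemma not_rad_iso:
  assumes "i < n" "j < n" "e i * x = x" "x * e j = x" "x \<notin> rad"
  shows "i = j" "unit_in (e i) x"
proof -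
  obtain k y z where k: "k < n" and u: "unit_in (e k) (e k * y * x * z * e k)"
    using assms(5) unfolding rad_def by blast
  then obtain w where w: "e k * w = w" "w * e k = w" "e k * y * x * z * e k * w = e k"
    unfolding unit_in_def by blast
  let ?a = "e k * y * e i" and ?b = "x * z * e k * w"
  have "?a * ?b = e k * y * (e i * x) * z * e k * w" by (simp add: mult.assoc)
  then have ab: "?a * ?b = e k" using assms(3) w(3) by simp
  have cor: "e k * ?a = ?a" "?a * e i = ?a" "e i * ?b = ?b" "?b * e k = ?b"
    using idem[OF k] idem[OF assms(1)] assms(3) w(2) by (simp_all add: mult.assoc[symmetric])
      (simp_all add: mult.assoc)
  note ki = split_epi_iso[OF k assms(1) cor ab]
  let ?a' = "e k * y * x" and ?b' = "e j * z * e k * w"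
  have "?a' * ?b' = e k * y * (x * e j) * z * e k * w" by (simp add: mult.assoc)
  then have ab': "?a' * ?b' = e k" using assms(4) w(3) by simp
  have cor': "e k * ?a' = ?a'" "?a' * e j = ?a'" "e j * ?b' = ?b'" "?b' * e k = ?b'"
    using idem[OF k] idem[OF assms(2)] assms(4) w(2) by (simp_all add: mult.assoc[symmetric])
      (simp_all add: mult.assoc)
  note kj = split_epi_iso[OF k assms(2) cor' ab']
  show ij: "i = j" using ki(1) kj(1) by simp
  \<comment> \<open>Since \<open>x * ?b'\<close> equals \<open>?b\<close>, the identity
    \<open>?b * ?a = e i\<close> makes \<open>?r\<close> a right inverse of
    \<open>x\<close>.\<close>
  let ?r = "?b' * ?a"
  have "x * ?r = (x * e j) * z * e k * w * ?a" by (simp add: mult.assoc)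
  also have "\<dots> = e i" using ki(2) assms(4) by simp
  finally have xr: "x * ?r = e i" .
  have r: "e i * ?r = ?r" "?r * e i = ?r"
    using cor'(3) cor(2) ij by (metis mult.assoc)+
  have "?r * x = e i"
    by (rule split_epi_iso(2)[OF assms(1,1,3) _ r xr]) (use assms(4) ij in simp)
  then show "unit_in (e i) x" unfolding unit_in_def using r xr by blast
qed

lemma unit_in_self: "i < n \<Longrightarrow> unit_in (e i) (e i)"
  using idem unfolding unit_in_def by blast

lemma idem_not_rad: "i < n \<Longrightarrow> e i \<notin> rad"
proof
  assume i: "i < n" and "e i \<in> rad"
  then have "\<not> unit_in (e i) (e i * 1 * e i * 1 * e i)" unfolding rad_def by blast
  then show False using i idem unit_in_self by simp
qed

lemma unit_in_if_rad:
  assumes "i < n" "e i * x = x" "x * e i = x" "x - e i \<in> rad"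
  shows "unit_in (e i) x"
proof (rule ccontr)
  assume "\<not> unit_in (e i) x"
  then have "unit_in (e i) (e i - x)" using loc assms by blast
  moreover have "e i - x = e i * 1 * (e i - x) * 1 * e i"
    using assms idem by (simp add: algebra_simps)
  moreover have "e i - x \<in> rad" using rad_uminus[OF assms(4)] by simp
  ultimately show False using assms(1) unfolding rad_def by (metis (mono_tags, lifting) mem_Collect_eq)
qed

end

section \<open>Complexes of projectives as matrices\<close>

definition cx :: "(nat \<Rightarrow> 'a::ring_1) \<Rightarrow> 'a cplx \<Rightarrow> 'a fmat cpx" where
  "cx e T = (ids e (deg1 T), ids e (deg0 T), trunc (length (deg0 T)) (length (deg1 T)) (dif T))"

text \<open>\<open>pin\<close> and \<open>pout\<close> include and project onto the summands \<open>ps\<close> of a longer list, in which they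
  occupy the positions given by \<open>\<phi>\<close>.\<close>

definition pin :: "(nat \<Rightarrow> 'a::zero) \<Rightarrow> (nat \<Rightarrow> nat) \<Rightarrow> nat list \<Rightarrow> 'a fmat" where
  "pin e \<phi> ps = Abs_fmat (\<lambda>q p. if p < length ps \<and> q = \<phi> p then e (ps ! p) else 0)"

definition pout :: "(nat \<Rightarrow> 'a::zero) \<Rightarrow> (nat \<Rightarrow> nat) \<Rightarrow> nat list \<Rightarrow> 'a fmat" where
  "pout e \<phi> ps = Abs_fmat (\<lambda>q p. if q < length ps \<and> p = \<phi> q then e (ps ! q) else 0)"

lemma entry_pin [simp]: "entry (pin e \<phi> ps) q p = (if p < length ps \<and> q = \<phi> p then e (ps ! p) else 0)"
proof -
  obtain k where k: "\<And>p. p < length ps \<Longrightarrow> \<phi> p < k"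
    using finite_nat_set_iff_bounded[of "\<phi> ` {..<length ps}"] by auto
  show ?thesis unfolding pin_def
    by (subst entry_Abs_fmat[of "max k (length ps)"]) (auto dest: k)
qed

lemma entry_pout [simp]: "entry (pout e \<phi> ps) q p = (if q < length ps \<and> p = \<phi> q then e (ps ! q) else 0)"
proof -
  obtain k where k: "\<And>p. p < length ps \<Longrightarrow> \<phi> p < k"
    using finite_nat_set_iff_bounded[of "\<phi> ` {..<length ps}"] by auto
  show ?thesis unfolding pout_def
    by (subst entry_Abs_fmat[of "max k (length ps)"]) (auto dest: k)
qed

lemma entry_mult_pin:
  "entry (A * pin e \<phi> ps) q p = (if p < length ps then entry A q (\<phi> p) * e (ps ! p) else 0)"
  for A :: "'a::ring fmat"
  by (subst entry_mult[of "Suc (\<phi> p)"]) auto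

lemma entry_pout_mult:
  "entry (pout e \<phi> ps * A) q p = (if q < length ps then e (ps ! q) * entry A (\<phi> q) p else 0)"
  for A :: "'a::ring fmat"
  by (subst entry_mult[of "Suc (\<phi> q)"]) auto

text \<open>\<open>L_corner\<close> puts the full diagonal corners into \<open>L\<close>. Inverses
  found in these local corners therefore stay in \<open>L\<close>, and the radical of the ambient
  algebra can be used over \<open>L\<close>.\<close>

locale corner_subring = basic_idems n e for n and e :: "nat \<Rightarrow> 'a::ring_1" +
  fixes L :: "'a set"
  assumes L_zero: "0 \<in> L"
    and L_add: "x \<in> L \<Longrightarrow> y \<in> L \<Longrightarrow> x + y \<in> L"
    and L_diff: "x \<in> L \<Longrightarrow> y \<in> L \<Longrightarrow> x - y \<in> L"
    and L_mult: "x \<in> L \<Longrightarrow> y \<in> L \<Longrightarrow> x * y \<in> L"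
    and L_corner: "i < n \<Longrightarrow> e i * x * e i \<in> L"
begin

sublocale subrng "mats L"
proof
  show "A * B \<in> mats L" if "A \<in> mats L" "B \<in> mats L" for A B
  proof -
    obtain k where k: "\<And>l q p B. k \<le> l \<Longrightarrow> entry (A * B) q p = (\<Sum>r<l. entry A q r * entry B r p)"
      by (rule entry_mult_large[of A]) blast
    have "(\<Sum>r<l. entry A q r * entry B r p) \<in> L" for l q p
      using that by (induction l) (auto simp: mats_def L_zero L_add L_mult)
    then show ?thesis using k[of k] by (simp add: mats_def)
  qed
qed (auto simp: mats_def L_zero L_add L_diff)

lemma e_in_L: "i < n \<Longrightarrow> e i \<in> L"
  using L_corner[of i "e i"] idem by simp

abbreviation ok :: "nat list \<Rightarrow> bool" where
  "ok ps \<equiv> set ps \<subseteq> {..<n}"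

lemma ok_nth: "ok ps \<Longrightarrow> p < length ps \<Longrightarrow> ps ! p < n"
  using nth_mem by blast

section \<open>Dictionary between the given definitions and complexes in the matrix ring\<close>

lemma Hom_idsI:
  assumes "\<And>q p. q < length qs \<Longrightarrow> p < length ps \<Longrightarrow>
       entry X q p \<in> L \<and> e (qs ! q) * entry X q p = entry X q p \<and> entry X q p * e (ps ! p) = entry X q p"
    and "\<And>q p. \<not> (q < length qs \<and> p < length ps) \<Longrightarrow> entry X q p = 0"
  shows "Hom (ids e ps) (ids e qs) X"
proof -
  have "entry X q p \<in> L" for q p using assms[of q p] L_zero by (cases "q < length qs \<and> p < length ps") auto
  moreover have "ids e qs * X = X" "X * ids e ps = X"
  proof -
    have "entry (ids e qs * X) q p = entry X q p \<and> entry (X * ids e ps) q p = entry X q p" for q p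
      using assms[of q p] by (cases "q < length qs \<and> p < length ps") (auto simp: entry_mult_ids entry_ids_mult)
    then show "ids e qs * X = X" "X * ids e ps = X" by (auto intro: fmat_eqI)
  qed
  ultimately show ?thesis unfolding Hom_def by (simp add: mats_def)
qed

lemma Hom_idsD:
  assumes "Hom (ids e ps) (ids e qs) X"
  shows "entry X q p \<in> L" "q < length qs \<Longrightarrow> e (qs ! q) * entry X q p = entry X q p"
    "p < length ps \<Longrightarrow> entry X q p * e (ps ! p) = entry X q p"
    "\<not> (q < length qs \<and> p < length ps) \<Longrightarrow> entry X q p = 0"
proof -
  have X: "ids e qs * X = X" "X * ids e ps = X" "X \<in> mats L" using assms by (auto simp: Hom_def)
  show "entry X q p \<in> L" using X by (auto simp: mats_def)
  show "q < length qs \<Longrightarrow> e (qs ! q) * entry X q p = entry X q p"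
    using arg_cong[OF X(1), of "\<lambda>A. entry A q p"] by (simp add: entry_ids_mult)
  show "p < length ps \<Longrightarrow> entry X q p * e (ps ! p) = entry X q p"
    using arg_cong[OF X(2), of "\<lambda>A. entry A q p"] by (simp add: entry_mult_ids)
  show "\<not> (q < length qs \<and> p < length ps) \<Longrightarrow> entry X q p = 0"
    using arg_cong[OF X(1), of "\<lambda>A. entry A q p"] arg_cong[OF X(2), of "\<lambda>A. entry A q p"]
    by (auto simp: entry_ids_mult entry_mult_ids split: if_splits)
qed

lemma hom_iff_Hom:
  assumes "ok ps" "ok qs"
  shows "hom L e ps qs M \<longleftrightarrow> Hom (ids e ps) (ids e qs) (trunc (length qs) (length ps) M)"
proof
  assume h: "hom L e ps qs M"
  show "Hom (ids e ps) (ids e qs) (trunc (length qs) (length ps) M)"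
  proof (rule Hom_idsI)
    fix q p assume qp: "q < length qs" "p < length ps"
    then have M: "M q p \<in> L" "M q p = e (qs ! q) * M q p * e (ps ! p)" using h by (auto simp: hom_def)
    have "e (qs ! q) * M q p = M q p" "M q p * e (ps ! p) = M q p"
      using idem[OF ok_nth[OF assms(1) qp(2)]] idem[OF ok_nth[OF assms(2) qp(1)]]
      by (subst (1 2) M(2), metis mult.assoc)+
    then show "entry (trunc (length qs) (length ps) M) q p \<in> L \<and>
      e (qs ! q) * entry (trunc (length qs) (length ps) M) q p = entry (trunc (length qs) (length ps) M) q p \<and>
      entry (trunc (length qs) (length ps) M) q p * e (ps ! p) = entry (trunc (length qs) (length ps) M) q p"
      using M(1) qp by simp
  qed auto
next
  assume H: "Hom (ids e ps) (ids e qs) (trunc (length qs) (length ps) M)"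
  have "M q p \<in> L \<and> M q p = e (qs ! q) * M q p * e (ps ! p)" if "q < length qs" "p < length ps" for q p
    using Hom_idsD[OF H, where q = q and p = p] that by simp
  then show "hom L e ps qs M" by (simp add: hom_def)
qed

text \<open>\<open>entry\<close> is a section of truncation, so every morphism of the matrix ring
  comes from a matrix in the sense of the definitions.\<close>

lemma Hom_trunc:
  "Hom (ids e ps) (ids e qs) X \<Longrightarrow> trunc (length qs) (length ps) (entry X) = X"
  by (rule fmat_eqI) (auto dest: Hom_idsD(4))

lemma Hom_ids: "ok ps \<Longrightarrow> Hom (ids e ps) (ids e ps) (ids e ps)"
  by (rule Hom_idsI) (auto simp: L_zero e_in_L ok_nth idem)

lemma valid_cplx_iff:
  "valid_cplx L e n T \<longleftrightarrow> ok (deg1 T) \<and> ok (deg0 T) \<and> obj (cx e T)"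
  using hom_iff_Hom[of "deg1 T" "deg0 T" "dif T"] Hom_ids
  by (auto simp: valid_cplx_def cx_def)

lemma chain_map_iff:
  assumes "valid_cplx L e n T" "valid_cplx L e n T'"
  shows "chain_map L e T T' f1 f0 \<longleftrightarrow> cmap (cx e T) (cx e T')
    (trunc (length (deg1 T')) (length (deg1 T)) f1) (trunc (length (deg0 T')) (length (deg0 T)) f0)"
  using assms by (simp add: chain_map_def cx_def valid_cplx_def hom_iff_Hom meq_iff_trunc trunc_mmul)

lemma null_htpc_iff:
  assumes "valid_cplx L e n T" "valid_cplx L e n T'"
  shows "null_htpc L e T T' f1 f0 \<longleftrightarrow> null (cx e T) (cx e T')
    (trunc (length (deg1 T')) (length (deg1 T)) f1) (trunc (length (deg0 T')) (length (deg0 T)) f0)"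
  using assms
  by (auto simp: null_htpc_def cx_def valid_cplx_def hom_iff_Hom meq_iff_trunc trunc_mmul)
     (metis Hom_trunc)

lemma homeq_iff_heq:
  assumes "valid_cplx L e n T" "valid_cplx L e n T'"
  shows "homeq L e T T' \<longleftrightarrow> heq (cx e T) (cx e T')"
proof
  assume "homeq L e T T'"
  then show "heq (cx e T) (cx e T')"
    using assms unfolding homeq_def
    by (simp add: chain_map_iff null_htpc_iff trunc_msub trunc_mmul trunc_idm)
       (simp add: cx_def del: cmap.simps null.simps, blast)
next
  assume "heq (cx e T) (cx e T')"
  then obtain f1 f0 g1 g0 where fg: "cmap (cx e T) (cx e T') f1 f0" "cmap (cx e T') (cx e T) g1 g0"
      "null (cx e T) (cx e T) (g1 * f1 - ids e (deg1 T)) (g0 * f0 - ids e (deg0 T))"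
      "null (cx e T') (cx e T') (f1 * g1 - ids e (deg1 T')) (f0 * g0 - ids e (deg0 T'))"
    unfolding cx_def heq.simps by blast
  then have "trunc (length (deg1 T')) (length (deg1 T)) (entry f1) = f1"
    "trunc (length (deg0 T')) (length (deg0 T)) (entry f0) = f0"
    "trunc (length (deg1 T)) (length (deg1 T')) (entry g1) = g1"
    "trunc (length (deg0 T)) (length (deg0 T')) (entry g0) = g0"
    by (auto simp: cx_def intro: Hom_trunc)
  with fg show "homeq L e T T'" using assms unfolding homeq_def
    by - (rule exI[of _ "entry f1"], rule exI[of _ "entry f0"], rule exI[of _ "entry g1"],
        rule exI[of _ "entry g0"],
        simp add: chain_map_iff null_htpc_iff trunc_msub trunc_mmul trunc_idm)
qed

lemma zero_K_iff: "valid_cplx L e n T \<Longrightarrow> zero_K L e T \<longleftrightarrow> contractible (cx e T)"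
  by (simp add: zero_K_def null_htpc_iff trunc_idm) (simp add: cx_def)

lemma presilting_iff: "valid_cplx L e n T \<Longrightarrow> presilting L e T \<longleftrightarrow> rigid (cx e T) (cx e T)"
proof
  assume T: "valid_cplx L e n T" "presilting L e T"
  have ok: "ok (deg1 T)" "ok (deg0 T)" using T by (auto simp: valid_cplx_def)
  show "rigid (cx e T) (cx e T)" unfolding cx_def rigid.simps
  proof (intro allI impI)
    fix x assume x: "Hom (ids e (deg1 T)) (ids e (deg0 T)) x"
    then have "hom L e (deg1 T) (deg0 T) (entry x)" using ok by (simp add: hom_iff_Hom Hom_trunc)
    then obtain a b where "hom L e (deg1 T) (deg1 T) a" "hom L e (deg0 T) (deg0 T) b"
      "meq (length (deg0 T)) (length (deg1 T)) (entry x)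
             (madd (mmul (length (deg1 T)) (dif T) a) (mmul (length (deg0 T)) b (dif T)))"
      using T(2) unfolding presilting_def by blast
    then show "\<exists>a b. Hom (ids e (deg1 T)) (ids e (deg1 T)) a \<and> Hom (ids e (deg0 T)) (ids e (deg0 T)) b \<and>
        x = trunc (length (deg0 T)) (length (deg1 T)) (dif T) * a +
            b * trunc (length (deg0 T)) (length (deg1 T)) (dif T)"
      using ok x by (auto simp: hom_iff_Hom meq_iff_trunc trunc_madd trunc_mmul Hom_trunc)
  qed
next
  assume T: "valid_cplx L e n T" "rigid (cx e T) (cx e T)"
  have ok: "ok (deg1 T)" "ok (deg0 T)" using T by (auto simp: valid_cplx_def)
  show "presilting L e T" unfolding presilting_def
  proof (intro allI impI)
    fix g assume "hom L e (deg1 T) (deg0 T) g"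
    then obtain a b where "Hom (ids e (deg1 T)) (ids e (deg1 T)) a" "Hom (ids e (deg0 T)) (ids e (deg0 T)) b"
      "trunc (length (deg0 T)) (length (deg1 T)) g = trunc (length (deg0 T)) (length (deg1 T)) (dif T) * a +
            b * trunc (length (deg0 T)) (length (deg1 T)) (dif T)"
      using T(2) ok by (auto simp: cx_def hom_iff_Hom)
    then show "\<exists>a b. hom L e (deg1 T) (deg1 T) a \<and> hom L e (deg0 T) (deg0 T) b \<and>
           meq (length (deg0 T)) (length (deg1 T)) g
             (madd (mmul (length (deg1 T)) (dif T) a) (mmul (length (deg0 T)) b (dif T)))"
      using ok
      by - (rule exI[of _ "entry a"], rule exI[of _ "entry b"],
         simp add: hom_iff_Hom meq_iff_trunc trunc_madd trunc_mmul Hom_trunc)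
  qed
qed

lemma cplx_of_Hom:
  assumes "ok ps" "ok qs" "Hom (ids e ps) (ids e qs) D"
  shows "valid_cplx L e n (ps, qs, entry D)" "cx e (ps, qs, entry D) = (ids e ps, ids e qs, D)"
proof -
  show *: "cx e (ps, qs, entry D) = (ids e ps, ids e qs, D)"
    using assms(3) by (simp add: cx_def deg1_def deg0_def dif_def Hom_trunc)
  show "valid_cplx L e n (ps, qs, entry D)"
    unfolding valid_cplx_iff * using assms Hom_ids by (simp add: deg1_def deg0_def)
qed

section \<open>Inclusions, projections and direct sums\<close>

lemma Hom_pin:
  assumes "ok ps" "\<And>p. p < length ps \<Longrightarrow> \<phi> p < length rs \<and> rs ! \<phi> p = ps ! p"
  shows "Hom (ids e ps) (ids e rs) (pin e \<phi> ps)"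
  by (rule Hom_idsI) (use assms in \<open>auto simp: L_zero e_in_L ok_nth idem\<close>)

lemma Hom_pout:
  assumes "ok ps" "\<And>p. p < length ps \<Longrightarrow> \<phi> p < length rs \<and> rs ! \<phi> p = ps ! p"
  shows "Hom (ids e rs) (ids e ps) (pout e \<phi> ps)"
  by (rule Hom_idsI) (use assms in \<open>auto simp: L_zero e_in_L ok_nth idem\<close>)

lemma pout_pin:
  assumes "ok ps" "inj_on \<phi> {..<length ps}"
  shows "pout e \<phi> ps * pin e \<phi> ps = ids e ps"
  by (rule fmat_eqI) (use assms in \<open>auto simp: entry_pout_mult idem ok_nth dest: inj_onD\<close>)

lemma pout_pin_zero:
  assumes "\<And>p q. p < length ps \<Longrightarrow> q < length qs \<Longrightarrow> \<phi> p \<noteq> \<psi> q"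
  shows "pout e \<phi> ps * pin e \<psi> qs = 0"
  by (rule fmat_eqI) (use assms in \<open>auto simp: entry_pout_mult\<close>)

lemma entry_pin_pout:
  assumes "ok ps" "inj_on \<phi> {..<length ps}"
    "\<And>p. p < length ps \<Longrightarrow> \<phi> p < length rs \<and> rs ! \<phi> p = ps ! p"
  shows "entry (pin e \<phi> ps * pout e \<phi> ps) q p = (if q = p \<and> p \<in> \<phi> ` {..<length ps} then e (rs ! p) else 0)"
proof -
  have "entry (pin e \<phi> ps * pout e \<phi> ps) q p =
      (\<Sum>r<length ps. if q = \<phi> r \<and> p = \<phi> r then e (ps ! r) else 0)"
    by (subst entry_mult[of "length ps"]) (auto intro!: sum.cong simp: idem ok_nth assms(1))
  also have "\<dots> = (if q = p \<and> p \<in> \<phi> ` {..<length ps} then e (rs ! p) else 0)"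
  proof (cases "q = p \<and> p \<in> \<phi> ` {..<length ps}")
    case True
    then obtain s where s: "s < length ps" "p = \<phi> s" "q = \<phi> s" by auto
    have "(\<Sum>r<length ps. if q = \<phi> r \<and> p = \<phi> r then e (ps ! r) else 0) = (\<Sum>r<length ps. if r = s then e (ps ! r) else 0)"
      using s assms(2) by (intro sum.cong) (auto dest: inj_onD)
    then show ?thesis using s assms(3) by auto
  next
    case False
    then show ?thesis by (auto intro!: sum.neutral)
  qed
  finally show ?thesis .
qed

lemma ids_append_biprod:
  assumes "ok ps1" "ok ps2"
  defines "i1 \<equiv> pin e id ps1" and "p1 \<equiv> pout e id ps1"
    and "i2 \<equiv> pin e ((+) (length ps1)) ps2" and "p2 \<equiv> pout e ((+) (length ps1)) ps2"
  shows "Hom (ids e ps1) (ids e (ps1 @ ps2)) i1" "Hom (ids e ps2) (ids e (ps1 @ ps2)) i2"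
    "Hom (ids e (ps1 @ ps2)) (ids e ps1) p1" "Hom (ids e (ps1 @ ps2)) (ids e ps2) p2"
    "p1 * i1 = ids e ps1" "p2 * i2 = ids e ps2" "p1 * i2 = 0" "p2 * i1 = 0"
    "i1 * p1 + i2 * p2 = ids e (ps1 @ ps2)"
proof -
  show "Hom (ids e ps1) (ids e (ps1 @ ps2)) i1" "Hom (ids e ps2) (ids e (ps1 @ ps2)) i2"
    unfolding i1_def i2_def using assms(1,2) by (auto intro!: Hom_pin simp: nth_append)
  show "Hom (ids e (ps1 @ ps2)) (ids e ps1) p1" "Hom (ids e (ps1 @ ps2)) (ids e ps2) p2"
    unfolding p1_def p2_def using assms(1,2) by (auto intro!: Hom_pout simp: nth_append)
  show "p1 * i1 = ids e ps1" "p2 * i2 = ids e ps2"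
    unfolding i1_def i2_def p1_def p2_def using assms(1,2) by (auto intro!: pout_pin)
  show "p1 * i2 = 0" "p2 * i1 = 0"
    unfolding i1_def i2_def p1_def p2_def by (auto intro!: pout_pin_zero)
  have im: "(+) (length ps1) ` {..<length ps2} = {length ps1..<length ps1 + length ps2}"
    by (simp add: lessThan_atLeast0 add.commute)
  show "i1 * p1 + i2 * p2 = ids e (ps1 @ ps2)"
  proof (rule fmat_eqI)
    fix q p
    have "entry (i1 * p1) q p = (if q = p \<and> p \<in> id ` {..<length ps1} then e ((ps1 @ ps2) ! p) else 0)"
      unfolding i1_def p1_def using assms(1) by (intro entry_pin_pout) (auto simp: nth_append)
    moreover have "entry (i2 * p2) q p = (if q = p \<and> p \<in> (+) (length ps1) ` {..<length ps2} then e ((ps1 @ ps2) ! p) else 0)"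
      unfolding i2_def p2_def using assms(2) by (intro entry_pin_pout) (auto simp: nth_append)
    ultimately show "entry (i1 * p1 + i2 * p2) q p = entry (ids e (ps1 @ ps2)) q p"
      unfolding im by auto
  qed
qed

lemma valid_dsum:
  assumes "valid_cplx L e n T1" "valid_cplx L e n T2"
  shows "valid_cplx L e n (dsum T1 T2)"
  using assms
  by (auto simp: valid_cplx_def dsum_def deg1_def deg0_def dif_def hom_def nth_append L_zero)

lemma biprod_dsum:
  assumes T1: "valid_cplx L e n T1" and T2: "valid_cplx L e n T2"
  obtains i j p q where "biprod (cx e (dsum T1 T2)) (cx e T1) (cx e T2) i j p q"
proof -
  have ok: "ok (deg1 T1)" "ok (deg0 T1)" "ok (deg1 T2)" "ok (deg0 T2)"
    using assms by (auto simp: valid_cplx_def)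
  have deg: "deg1 (dsum T1 T2) = deg1 T1 @ deg1 T2" "deg0 (dsum T1 T2) = deg0 T1 @ deg0 T2"
    by (simp_all add: dsum_def deg1_def deg0_def)
  let ?d = "trunc (length (deg0 T1 @ deg0 T2)) (length (deg1 T1 @ deg1 T2)) (dif (dsum T1 T2))"
  have d: "dif (dsum T1 T2) q p = (if q < length (deg0 T1) then
                (if p < length (deg1 T1) then dif T1 q p else 0)
             else (if p < length (deg1 T1) then 0
                   else dif T2 (q - length (deg0 T1)) (p - length (deg1 T1))))" for q p
    by (simp add: dsum_def dif_def)
  have cx: "cx e (dsum T1 T2) = (ids e (deg1 T1 @ deg1 T2), ids e (deg0 T1 @ deg0 T2), ?d)"
    by (simp add: cx_def deg)
  have H: "Hom (ids e (deg1 T1 @ deg1 T2)) (ids e (deg0 T1 @ deg0 T2)) ?d"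
    using valid_dsum[OF assms] unfolding valid_cplx_iff cx by simp
  have c: "e (deg0 T ! q) * (dif T q p * e (deg1 T ! p)) = dif T q p"
    if "valid_cplx L e n T" "q < length (deg0 T)" "p < length (deg1 T)" for T q p
    using that unfolding valid_cplx_def hom_def by (metis mult.assoc)
  note b = biprodI[OF H ids_append_biprod[OF ok(1,3)] ids_append_biprod[OF ok(2,4)],
     of "trunc (length (deg0 T1)) (length (deg1 T1)) (dif T1)" "trunc (length (deg0 T2)) (length (deg1 T2)) (dif T2)"]
  have "biprod (cx e (dsum T1 T2)) (cx e T1) (cx e T2)
    (pin e id (deg1 T1), pin e id (deg0 T1))
    (pin e ((+) (length (deg1 T1))) (deg1 T2), pin e ((+) (length (deg0 T1))) (deg0 T2))
    (pout e id (deg1 T1), pout e id (deg0 T1))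
    (pout e ((+) (length (deg1 T1))) (deg1 T2), pout e ((+) (length (deg0 T1))) (deg0 T2))"
    unfolding cx cx_def[of e T1] cx_def[of e T2]
    by (rule b; rule fmat_eqI; simp add: entry_mult_pin entry_pout_mult mult.assoc d c T1 T2)
  then show thesis by (rule that)
qed

lemma heq_dsum:
  assumes "valid_cplx L e n T1" "valid_cplx L e n T2" "valid_cplx L e n T1'" "valid_cplx L e n T2'"
    and "heq (cx e T1) (cx e T1')" "heq (cx e T2) (cx e T2')"
  shows "heq (cx e (dsum T1 T2)) (cx e (dsum T1' T2'))"
  by (rule biprod_dsum[OF assms(1,2)], rule biprod_dsum[OF assms(3,4)], rule heq_biprod[OF assms(5,6)])

lemma retract_dsum:
  assumes "valid_cplx L e n T1" "valid_cplx L e n T2"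
  shows "retract (cx e T1) (cx e (dsum T1 T2))" "retract (cx e T2) (cx e (dsum T1 T2))"
  by (rule biprod_dsum[OF assms], erule biprod_retract)+

lemma rigid_zero_cplx: "rigid (cx e zero_cplx) X" "rigid X (cx e zero_cplx)"
proof -
  have "Hom P 0 x \<Longrightarrow> x = 0" "Hom 0 P x \<Longrightarrow> x = 0" for P x by (auto simp: Hom_def)
  moreover have "cx e zero_cplx = (0, 0, 0)"
    by (auto simp: cx_def zero_cplx_def deg1_def deg0_def dif_def intro!: fmat_eqI)
  ultimately show "rigid (cx e zero_cplx) X" "rigid X (cx e zero_cplx)"
    by (cases X; auto intro!: exI[of _ 0] Hom_zero; fail)+
qed

lemma valid_dsum_list:
  "\<forall>T\<in>set Ts. valid_cplx L e n T \<Longrightarrow> valid_cplx L e n (dsum_list Ts)"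
proof (induction Ts)
  case Nil
  show ?case by (simp add: dsum_list_def zero_cplx_def valid_cplx_def deg1_def deg0_def hom_def)
next
  case (Cons T Ts)
  then show ?case using valid_dsum by (simp add: dsum_list_def)
qed

lemma rigid_dsum_list_left:
  "\<forall>T\<in>set Ts. valid_cplx L e n T \<Longrightarrow>
    rigid (cx e (dsum_list Ts)) X \<longleftrightarrow> (\<forall>T\<in>set Ts. rigid (cx e T) X)"
proof (induction Ts)
  case Nil
  show ?case using rigid_zero_cplx by (simp add: dsum_list_def)
next
  case (Cons T Ts)
  then have T: "valid_cplx L e n T" "valid_cplx L e n (dsum_list Ts)" using valid_dsum_list by auto
  obtain i j p q where b: "biprod (cx e (dsum T (dsum_list Ts))) (cx e T) (cx e (dsum_list Ts)) i j p q"
    by (rule biprod_dsum[OF T])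
  have eq: "dsum_list (T # Ts) = dsum T (dsum_list Ts)" by (simp add: dsum_list_def)
  have "rigid (cx e (dsum T (dsum_list Ts))) X \<longleftrightarrow> rigid (cx e T) X \<and> rigid (cx e (dsum_list Ts)) X"
    by (rule iffI, rule conjI)
       (erule rigid_retract_left[OF biprod_retract(1)[OF b]] rigid_retract_left[OF biprod_retract(2)[OF b]]
         conjE biprod_rigid_left[OF b] | assumption)+
  also have "rigid (cx e (dsum_list Ts)) X \<longleftrightarrow> (\<forall>T\<in>set Ts. rigid (cx e T) X)"
    using Cons by simp
  finally show ?case unfolding eq by simp
qed

lemma rigid_dsum_list_right:
  "\<forall>T\<in>set Ts. valid_cplx L e n T \<Longrightarrow>
    rigid X (cx e (dsum_list Ts)) \<longleftrightarrow> (\<forall>T\<in>set Ts. rigid X (cx e T))"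
proof (induction Ts)
  case Nil
  show ?case using rigid_zero_cplx by (simp add: dsum_list_def)
next
  case (Cons T Ts)
  then have T: "valid_cplx L e n T" "valid_cplx L e n (dsum_list Ts)" using valid_dsum_list by auto
  obtain i j p q where b: "biprod (cx e (dsum T (dsum_list Ts))) (cx e T) (cx e (dsum_list Ts)) i j p q"
    by (rule biprod_dsum[OF T])
  have eq: "dsum_list (T # Ts) = dsum T (dsum_list Ts)" by (simp add: dsum_list_def)
  have "rigid X (cx e (dsum T (dsum_list Ts))) \<longleftrightarrow> rigid X (cx e T) \<and> rigid X (cx e (dsum_list Ts))"
    by (rule iffI, rule conjI)
       (erule rigid_retract_right[OF biprod_retract(1)[OF b]] rigid_retract_right[OF biprod_retract(2)[OF b]]
         conjE biprod_rigid_right[OF b] | assumption)+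
  also have "rigid X (cx e (dsum_list Ts)) \<longleftrightarrow> (\<forall>T\<in>set Ts. rigid X (cx e T))"
    using Cons by simp
  finally show ?case unfolding eq by simp
qed

text \<open>In the pairwise form each summand can be replaced by a homotopy equivalent one, or moved
  to another subalgebra, on its own.\<close>

lemma presilting_dsum_list_iff:
  assumes "\<forall>T\<in>set Ts. valid_cplx L e n T"
  shows "presilting L e (dsum_list Ts) \<longleftrightarrow> (\<forall>T\<in>set Ts. \<forall>T'\<in>set Ts. rigid (cx e T) (cx e T'))"
  using assms
  by (simp add: presilting_iff valid_dsum_list rigid_dsum_list_left rigid_dsum_list_right) blast

section \<open>Matrices that are invertible modulo the radical\<close>

lemma mats_rad_add: "A \<in> mats rad \<Longrightarrow> B \<in> mats rad \<Longrightarrow> A + B \<in> mats rad"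
  by (simp add: mats_def rad_add)

lemma mats_rad_diff: "A \<in> mats rad \<Longrightarrow> B \<in> mats rad \<Longrightarrow> A - B \<in> mats rad"
  by (simp add: mats_def rad_diff)

lemma mats_rad_uminus: "A \<in> mats rad \<Longrightarrow> - A \<in> mats rad"
  by (simp add: mats_def rad_uminus)

lemma mats_rad_mult:
  assumes "A \<in> mats rad \<or> B \<in> mats rad"
  shows "A * B \<in> mats rad"
proof -
  obtain k where k: "\<And>l q p B. k \<le> l \<Longrightarrow> entry (A * B) q p = (\<Sum>r<l. entry A q r * entry B r p)"
    by (rule entry_mult_large[of A]) blast
  show ?thesis
    using k[OF order_refl] assms
    by (auto simp: mats_def intro!: rad_sum intro: rad_mult_left rad_mult_right)
qed

text \<open>The pivot of one elimination step: the diagonal entry differs from its idempotent by a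
  radical element and is therefore invertible in the local corner.\<close>

lemma single_unit_inverse:
  assumes ps: "ok ps" and k: "k < length ps"
    and X: "Hom (ids e ps) (ids e ps) X" "X - ids e ps \<in> mats rad"
  defines "D \<equiv> single k k (e (ps ! k))"
  obtains v where "v \<in> mats L" "D * v = v" "v * D = v" "v * X * D = D"
proof -
  let ?i = "ps ! k" and ?x = "entry X k k"
  have i: "?i < n" by (rule ok_nth[OF ps k])
  have x: "e ?i * ?x = ?x" "?x * e ?i = ?x" using Hom_idsD(2,3)[OF X(1)] k by auto
  have "entry (X - ids e ps) k k \<in> rad" using X(2) unfolding mats_def by blast
  then have "?x - e ?i \<in> rad" using k by simp
  from unit_in_if_rad[OF i x this] obtain y where y: "e ?i * y = y" "y * e ?i = y" "?x * y = e ?i" "y * ?x = e ?i"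
    unfolding unit_in_def by blast
  have "y = e ?i * y * e ?i" using y by simp
  then have yL: "y \<in> L" using L_corner[OF i, of y] by simp
  let ?v = "single k k y"
  show thesis
  proof (rule that[of ?v])
    show "?v \<in> mats L" using yL L_zero by (simp add: mats_def)
    show "D * ?v = ?v" "?v * D = ?v" unfolding D_def
      by (rule fmat_eqI; simp add: entry_single_mult y)+
    show "?v * X * D = D" unfolding D_def
      by (rule fmat_eqI) (simp add: entry_mult_single entry_single_mult y idem[OF i])
  qed
qed

text \<open>Gauss-Jordan elimination by columns. Every step preserves the congruence to the identity
  modulo \<open>rad\<close>, which keeps the later pivots invertible.\<close>

lemma left_inverse_mod_rad:
  assumes ps: "ok ps" and M: "Hom (ids e ps) (ids e ps) M" "M - ids e ps \<in> mats rad"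
  obtains X where "Hom (ids e ps) (ids e ps) X" "X * M = ids e ps"
proof -
  let ?E = "ids e ps"
  define F where "F k = trunc k k (entry ?E)" for k
  have EE: "Hom ?E ?E ?E" by (rule Hom_ids[OF ps])
  \<comment> \<open>\<open>F k\<close> is the identity cut off after \<open>k\<close> places, so the
    last condition says that the first \<open>k\<close> columns of \<open>X * M\<close> are those of
    the identity.\<close>
  have "\<exists>X. Hom ?E ?E X \<and> X * M - ?E \<in> mats rad \<and> X * M * F k = F k" if "k \<le> length ps" for k
    using that
  proof (induction k)
    case 0
    have "F 0 = 0" by (rule fmat_eqI) (simp add: F_def)
    then show ?case using M EE by (intro exI[of _ ?E]) (simp add: Hom_def)
  next
    case (Suc k)
    then obtain X where X: "Hom ?E ?E X" "X * M - ?E \<in> mats rad" "X * M * F k = F k" by auto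
    define N where "N = X * M"
    define D where "D = single k k (e (ps ! k))"
    have k: "k < length ps" using Suc by simp
    note i = ok_nth[OF ps k]
    have N: "Hom ?E ?E N" "N - ?E \<in> mats rad" "N * F k = F k"
      using X M Hom_comp by (auto simp: N_def)
    obtain v where v: "v \<in> mats L" "D * v = v" "v * D = v" "v * N * D = D"
      using single_unit_inverse[OF ps k N(1,2)] unfolding D_def by blast
    have D: "?E * D = D" "D * ?E = D" unfolding D_def
      by (rule fmat_eqI; simp add: entry_mult_ids entry_ids_mult idem[OF i] k)+
    have DF: "D * F k = 0" unfolding D_def F_def
      by (rule fmat_eqI) (simp add: entry_single_mult)
    have FS: "F (Suc k) = F k + D" unfolding D_def F_def
      by (rule fmat_eqI) (use k in auto)
    have Dm: "D \<in> mats L" unfolding D_def using e_in_L[OF i] L_zero by (simp add: mats_def)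
    \<comment> \<open>The elementary matrix that turns column \<open>k\<close> of \<open>N\<close>
      into that of the identity. Earlier columns are untouched because
      \<open>v * F k = 0\<close>.\<close>
    define Y where "Y = ?E - (N - D) * v"
    have vE: "v * ?E = v" "?E * v = v" using v(2,3) D by (metis mult.assoc)+
    have "Hom ?E ?E v" using v(1) vE by (simp add: Hom_def)
    moreover have "Hom ?E ?E D" using Dm D by (simp add: Hom_def)
    ultimately have Y: "Hom ?E ?E Y" unfolding Y_def using EE N(1) by (meson Hom_comp Hom_diff)
    have EN: "?E * N = N" using N(1) by (simp add: Hom_def)
    have YN: "Y * N = N - (N - D) * v * N" by (simp add: Y_def left_diff_distrib EN)
    have "(N - D) * v = (N - ?E) * v"
      using v(2) vE by (simp add: left_diff_distrib)
    then have "Y * N - ?E = (N - ?E) - (N - ?E) * v * N" unfolding YN by (simp add: algebra_simps)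
    also have "\<dots> \<in> mats rad" by (rule mats_rad_diff) (use N(2) mats_rad_mult in blast)+
    finally have 1: "Y * N - ?E \<in> mats rad" .
    have vF: "v * F k = 0" using v(3) DF by (metis mult.assoc mult_zero_right)
    have "Y * N * F k = F k - (N - D) * (v * F k)"
      using N(3) by (simp add: YN left_diff_distrib mult.assoc)
    then have 2: "Y * N * F k = F k" using vF by simp
    have "Y * N * D = N * D - (N - D) * (v * N * D)" by (simp add: YN left_diff_distrib mult.assoc)
    also have "\<dots> = D * D" using v(4) by (simp add: left_diff_distrib)
    also have "\<dots> = D" unfolding D_def by (rule fmat_eqI) (simp add: entry_single_mult idem[OF i])
    finally have 3: "Y * N * D = D" .
    have "Y * N * F (Suc k) = F (Suc k)" unfolding FS using 2 3 by (simp add: distrib_left)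
    then show ?case using 1 Hom_comp[OF X(1) Y] unfolding N_def
      by (intro exI[of _ "Y * X"]) (simp add: mult.assoc)
  qed
  from this[of "length ps"] obtain X where X: "Hom ?E ?E X" "X * M * F (length ps) = F (length ps)" by auto
  have "F (length ps) = ?E" unfolding F_def by (rule fmat_eqI) simp
  then have "X * M = ?E" using X M by (simp add: Hom_def mult.assoc)
  then show thesis using X that by blast
qed

text \<open>A left inverse of \<open>M\<close> is again congruent to the identity, so it has a left
  inverse itself, which must be \<open>M\<close>.\<close>

lemma inverse_mod_rad:
  assumes ps: "ok ps" and M: "Hom (ids e ps) (ids e ps) M" "M - ids e ps \<in> mats rad"
  obtains X where "Hom (ids e ps) (ids e ps) X" "X * M = ids e ps" "M * X = ids e ps"
proof -
  let ?E = "ids e ps"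
  obtain X where X: "Hom ?E ?E X" "X * M = ?E" by (rule left_inverse_mod_rad[OF ps M])
  have "X - ?E = - (X * (M - ?E))" using X by (simp add: right_diff_distrib Hom_def)
  then have "X - ?E \<in> mats rad" using M(2) by (simp add: mats_rad_mult mats_rad_uminus)
  then obtain Y where Y: "Hom ?E ?E Y" "Y * X = ?E" by (rule left_inverse_mod_rad[OF ps X(1)])
  have "Y = Y * (X * M)" using X Y by (simp add: Hom_def)
  also have "\<dots> = M" using Y M by (simp add: mult.assoc[symmetric] Hom_def)
  finally show thesis using that X Y by blast
qed

section \<open>Minimal complexes\<close>

definition minimal :: "'a cplx \<Rightarrow> bool" where
  "minimal T \<longleftrightarrow> trunc (length (deg0 T)) (length (deg1 T)) (dif T) \<in> mats rad"

definition del :: "nat \<Rightarrow> 'b list \<Rightarrow> 'b list" where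
  "del p ps = take p ps @ drop (Suc p) ps"

lemma ids_del:
  assumes "ok ps" "k < length ps"
  defines "\<phi> \<equiv> \<lambda>p. if p < k then p else Suc p"
  defines "i \<equiv> pin e \<phi> (del k ps)" and "p \<equiv> pout e \<phi> (del k ps)"
  shows "Hom (ids e (del k ps)) (ids e ps) i" "Hom (ids e ps) (ids e (del k ps)) p"
    "p * i = ids e (del k ps)" "i * p = ids e ps - single k k (e (ps ! k))"
proof -
  have len: "length (del k ps) = length ps - 1" using assms(2) by (simp add: del_def)
  have ok': "ok (del k ps)" using assms(1) by (auto simp: del_def dest: in_set_takeD in_set_dropD)
  have nth: "\<phi> r < length ps \<and> ps ! \<phi> r = del k ps ! r" if "r < length (del k ps)" for r
    using that assms(2) unfolding len by (auto simp: del_def \<phi>_def nth_append min_def)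
  have inj: "inj_on \<phi> {..<length (del k ps)}" by (auto simp: inj_on_def \<phi>_def split: if_splits)
  show "Hom (ids e (del k ps)) (ids e ps) i" "Hom (ids e ps) (ids e (del k ps)) p"
    unfolding i_def p_def by (intro Hom_pin Hom_pout ok' nth; assumption)+
  show "p * i = ids e (del k ps)" unfolding i_def p_def by (rule pout_pin[OF ok' inj])
  have im: "\<phi> ` {..<length (del k ps)} = {..<length ps} - {k}"
  proof (intro equalityI subsetI)
    fix r assume r: "r \<in> {..<length ps} - {k}"
    then show "r \<in> \<phi> ` {..<length (del k ps)}"
      unfolding len using assms(2)
      by (intro image_eqI[of _ _ "if r < k then r else r - 1"]) (auto simp: \<phi>_def)
  qed (auto simp: len \<phi>_def split: if_splits)
  show "i * p = ids e ps - single k k (e (ps ! k))"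
  proof (rule fmat_eqI)
    fix q r
    have "entry (i * p) q r = (if q = r \<and> r \<in> \<phi> ` {..<length (del k ps)} then e (ps ! r) else 0)"
      unfolding i_def p_def by (rule entry_pin_pout[OF ok' inj nth])
    then show "entry (i * p) q r = entry (ids e ps - single k k (e (ps ! k))) q r"
      unfolding im using assms(2) by auto
  qed
qed

lemma count_list_del:
  "k < length ps \<Longrightarrow> count_list ps j = count_list (del k ps) j + (if ps ! k = j then 1 else 0)"
  by (subst id_take_nth_drop[of k ps]) (simp_all add: del_def)

text \<open>A nonradical entry of the differential is an isomorphism between summands with the same
  index, by \<open>not_rad_iso\<close>. Cancelling the two removes this index once from each degree,
  so the class is unchanged.\<close>

lemma reduce_step:
  assumes T: "valid_cplx L e n T" and "\<not> minimal T"
  shows "\<exists>T'. valid_cplx L e n T' \<and> heq (cx e T) (cx e T') \<and> cls T' = cls T \<and>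
    length (deg1 T') < length (deg1 T)"
proof -
  let ?ps = "deg1 T" and ?qs = "deg0 T"
  let ?d = "trunc (length ?qs) (length ?ps) (dif T)"
  have ok: "ok ?ps" "ok ?qs" and obj: "obj (ids e ?ps, ids e ?qs, ?d)"
    using T by (auto simp: valid_cplx_iff cx_def)
  then have d: "Hom (ids e ?ps) (ids e ?qs) ?d" by simp
  obtain q0 p0 where "entry ?d q0 p0 \<notin> rad" using assms(2) by (auto simp: minimal_def mats_def)
  then have q0: "q0 < length ?qs" and p0: "p0 < length ?ps" and nr: "entry ?d q0 p0 \<notin> rad"
    using Hom_idsD(4)[OF d] rad_zero by metis+
  let ?x = "entry ?d q0 p0" and ?i = "?ps ! p0"
  have i: "?i < n" by (rule ok_nth[OF ok(1) p0])
  have "?qs ! q0 = ?i" and u: "unit_in (e (?qs ! q0)) ?x"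
    using not_rad_iso[OF ok_nth[OF ok(2) q0] i Hom_idsD(2)[OF d q0] Hom_idsD(3)[OF d p0] nr] by auto
  then have qi: "?qs ! q0 = ?i" by simp
  obtain y where y: "e ?i * y = y" "y * e ?i = y" "?x * y = e ?i" "y * ?x = e ?i"
    using u unfolding unit_in_def qi by blast
  have "y = e ?i * y * e ?i" using y by simp
  then have yL: "y \<in> L" using L_corner[OF i, of y] by simp
  let ?v = "single p0 q0 y"
  have v: "Hom (ids e ?qs) (ids e ?ps) ?v"
    by (rule Hom_idsI) (use p0 q0 yL y qi L_zero in auto)
  let ?Ep = "single p0 p0 (e ?i)" and ?Eq = "single q0 q0 (e ?i)"
  have E: "?Ep * ?v = ?v" "?v * ?Eq = ?v" "?v * ?d * ?Ep = ?Ep" "?Eq * ?d * ?v = ?Eq"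
    "ids e ?ps * ?Ep = ?Ep" "?Ep * ids e ?ps = ?Ep" "ids e ?qs * ?Eq = ?Eq" "?Eq * ids e ?qs = ?Eq"
    using y idem[OF i] p0 q0 qi Hom_idsD(3)[OF d p0, of q0]
    by (auto intro!: fmat_eqI simp: entry_single_mult entry_mult_single entry_mult_ids entry_ids_mult mult.assoc)
  note P = ids_del[OF ok(1) p0] and Q = ids_del[OF ok(2) q0, unfolded qi]
  note H = heq_cancel[OF obj P Q v E]
  have ok': "ok (del p0 ?ps)" "ok (del q0 ?qs)"
    using ok by (auto simp: del_def dest: in_set_takeD in_set_dropD)
  note T' = cplx_of_Hom[OF ok' H(2)]
  let ?T = "(del p0 ?ps, del q0 ?qs, entry (pout e (\<lambda>p. if p < q0 then p else Suc p) (del q0 ?qs) *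
     (?d - ?d * ?v * ?d) * pin e (\<lambda>p. if p < p0 then p else Suc p) (del p0 ?ps)))"
  have "valid_cplx L e n ?T" by (rule T'(1))
  moreover have "heq (cx e T) (cx e ?T)" using H(1) unfolding T'(2) by (simp add: cx_def)
  moreover have "cls ?T = cls T"
    using count_list_del[OF p0] count_list_del[OF q0] qi
    by (auto simp: cls_def deg1_def deg0_def fun_eq_iff)
  moreover have "length (deg1 ?T) < length (deg1 T)" using p0 by (simp add: deg1_def del_def)
  ultimately show ?thesis by blast
qed

lemma ex_minimal:
  assumes "valid_cplx L e n T"
  shows "\<exists>T'. valid_cplx L e n T' \<and> heq (cx e T) (cx e T') \<and> cls T' = cls T \<and> minimal T'"
  using assms
proof (induction "length (deg1 T)" arbitrary: T rule: less_induct)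
  case less
  show ?case
  proof (cases "minimal T")
    case True
    then show ?thesis using less(2) heq_refl valid_cplx_iff by blast
  next
    case False
    then obtain T' where T': "valid_cplx L e n T'" "heq (cx e T) (cx e T')" "cls T' = cls T"
      "length (deg1 T') < length (deg1 T)" using reduce_step less(2) by blast
    from less(1)[OF T'(4,1)] T' show ?thesis using heq_trans by metis
  qed
qed

lemma ids_mult_single: "p < length ps \<Longrightarrow> ok ps \<Longrightarrow> ids e ps * single p p (e (ps ! p)) = single p p (e (ps ! p))"
  by (rule fmat_eqI) (simp add: entry_ids_mult ok_nth idem)

lemma single_not_rad: "p < length ps \<Longrightarrow> ok ps \<Longrightarrow> single q r (e (ps ! p)) \<notin> mats rad"
proof
  assume p: "p < length ps" "ok ps" and "single q r (e (ps ! p)) \<in> mats rad"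
  then have "entry (single q r (e (ps ! p))) q r \<in> rad" unfolding mats_def by blast
  then show False using idem_not_rad ok_nth p by simp
qed

text \<open>A contraction writes the identities of both terms as \<open>h * d\<close> and
  \<open>d * h\<close>, which are radical, whereas no \<open>e i\<close> is.\<close>

lemma contractible_minimal_empty:
  assumes T: "valid_cplx L e n T" "minimal T" "contractible (cx e T)"
  shows "deg1 T = [] \<and> deg0 T = []"
proof -
  have ok: "ok (deg1 T)" "ok (deg0 T)" using T by (auto simp: valid_cplx_def)
  have "ids e (deg1 T) \<in> mats rad" "ids e (deg0 T) \<in> mats rad"
    using T(2,3) by (auto simp: cx_def minimal_def intro: mats_rad_mult)
  moreover have "ids e ps \<in> mats rad \<Longrightarrow> ok ps \<Longrightarrow> ps = []" for ps
  proof (rule ccontr)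
    assume "ids e ps \<in> mats rad" "ok ps" "ps \<noteq> []"
    then have "entry (ids e ps) 0 0 \<in> rad" unfolding mats_def by blast
    then show False using idem_not_rad ok_nth[of ps 0] \<open>ok ps\<close> \<open>ps \<noteq> []\<close> by simp
  qed
  ultimately show ?thesis using ok by blast
qed

text \<open>An index of \<open>ps\<close> missing from \<open>qs\<close> would make a whole column
  of \<open>f\<close> radical, and then \<open>e i\<close> as well. Comparing sets without
  multiplicities is enough to read off signs.\<close>

lemma split_mono_subset:
  assumes ok: "ok ps" "ok qs" and f: "Hom (ids e ps) (ids e qs) f"
    and gf: "g * f - ids e ps \<in> mats rad"
  shows "set ps \<subseteq> set qs"
proof
  fix i assume "i \<in> set ps"
  then obtain p where p: "p < length ps" "ps ! p = i" by (metis in_set_conv_nth)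
  show "i \<in> set qs"
  proof (rule ccontr)
    assume "i \<notin> set qs"
    then have "entry f r p \<in> rad" for r
      using not_rad_iso(1)[OF ok_nth[OF ok(2)] ok_nth[OF ok(1) p(1)] Hom_idsD(2)[OF f] Hom_idsD(3)[OF f p(1)]]
        Hom_idsD(4)[OF f] rad_zero p(2) by (metis nth_mem)
    then have "f * single p p (e (ps ! p)) \<in> mats rad"
      by (simp add: mats_def entry_mult_single rad_zero rad_mult_right)
    then have "g * (f * single p p (e (ps ! p))) - (g * f - ids e ps) * single p p (e (ps ! p)) \<in> mats rad"
      using gf by (intro mats_rad_diff mats_rad_mult) auto
    moreover have "g * (f * single p p (e (ps ! p))) - (g * f - ids e ps) * single p p (e (ps ! p))
      = single p p (e (ps ! p))"
      using ids_mult_single[OF p(1) ok(1)] by (simp add: left_diff_distrib mult.assoc)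
    ultimately show False using single_not_rad[OF p(1) ok(1)] by simp
  qed
qed

text \<open>Since \<open>T\<close> is minimal, the errors \<open>h * d\<close> and
  \<open>d * h\<close> are radical, so the maps to \<open>T'\<close> are split monomorphisms modulo
  \<open>rad\<close> in each degree.\<close>

lemma retract_minimal_subset:
  assumes "valid_cplx L e n T" "valid_cplx L e n T'" "minimal T" "retract (cx e T) (cx e T')"
  shows "set (deg1 T) \<subseteq> set (deg1 T')" "set (deg0 T) \<subseteq> set (deg0 T')"
proof -
  let ?d = "trunc (length (deg0 T)) (length (deg1 T)) (dif T)"
  obtain f1 f0 g1 g0 h where f: "Hom (ids e (deg1 T)) (ids e (deg1 T')) f1"
     "Hom (ids e (deg0 T)) (ids e (deg0 T')) f0"
     and h: "g1 * f1 - ids e (deg1 T) = h * ?d" "g0 * f0 - ids e (deg0 T) = ?d * h"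
    using assms(4) by (auto simp: cx_def)
  have "g1 * f1 - ids e (deg1 T) \<in> mats rad" "g0 * f0 - ids e (deg0 T) \<in> mats rad"
    using assms(3) by (auto simp: h minimal_def intro: mats_rad_mult)
  then show "set (deg1 T) \<subseteq> set (deg1 T')" "set (deg0 T) \<subseteq> set (deg0 T')"
    using split_mono_subset f assms(1,2) unfolding valid_cplx_def by meson+
qed

text \<open>A common summand yields an identity \<open>e i\<close> regarded as a map from degree -1
  to degree 0. Rigidity writes it as d a + b d, which is radical.\<close>

lemma rigid_minimal_disjoint:
  assumes T: "valid_cplx L e n T" "minimal T" "rigid (cx e T) (cx e T)"
  shows "set (deg1 T) \<inter> set (deg0 T) = {}"
proof (rule ccontr)
  let ?d = "trunc (length (deg0 T)) (length (deg1 T)) (dif T)"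
  have ok: "ok (deg1 T)" "ok (deg0 T)" using T by (auto simp: valid_cplx_def)
  assume "set (deg1 T) \<inter> set (deg0 T) \<noteq> {}"
  then obtain p q where p: "p < length (deg1 T)" and q: "q < length (deg0 T)" and pq: "deg1 T ! p = deg0 T ! q"
    by (metis disjoint_iff in_set_conv_nth)
  let ?x = "single q p (e (deg1 T ! p))"
  have "Hom (ids e (deg1 T)) (ids e (deg0 T)) ?x"
    by (rule Hom_idsI) (use p q pq ok_nth[OF ok(1) p] in \<open>auto simp: e_in_L L_zero idem\<close>)
  then obtain a b where "?x = ?d * a + b * ?d" using T(3) by (auto simp: cx_def)
  then have "?x \<in> mats rad" using T(2) by (auto simp: minimal_def intro!: mats_rad_add mats_rad_mult)
  then show False using single_not_rad[OF p ok(1)] by blast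
qed

text \<open>Both composites are the identity plus a radical error, hence invertible in each degree.
  The given homotopy inverse is then exchanged for the true inverse.\<close>

lemma heq_minimal_iso:
  assumes T: "valid_cplx L e n T" "minimal T" and T': "valid_cplx L e n T'" "minimal T'"
    and heq: "heq (cx e T) (cx e T')"
  obtains f1 f0 g1 g0 where "cmap (cx e T) (cx e T') f1 f0" "cmap (cx e T') (cx e T) g1 g0"
    "g1 * f1 = ids e (deg1 T)" "g0 * f0 = ids e (deg0 T)"
    "f1 * g1 = ids e (deg1 T')" "f0 * g0 = ids e (deg0 T')"
proof -
  let ?d = "trunc (length (deg0 T)) (length (deg1 T)) (dif T)"
  let ?d' = "trunc (length (deg0 T')) (length (deg1 T')) (dif T')"
  obtain f1 f0 g1 g0 h h' where f: "cmap (cx e T) (cx e T') f1 f0" and g: "cmap (cx e T') (cx e T) g1 g0"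
     and h: "g1 * f1 - ids e (deg1 T) = h * ?d" "g0 * f0 - ids e (deg0 T) = ?d * h"
      "f1 * g1 - ids e (deg1 T') = h' * ?d'" "f0 * g0 - ids e (deg0 T') = ?d' * h'"
    using heq unfolding cx_def heq.simps null.simps by blast
  \<comment> \<open>\<open>X * w\<close> is a left inverse and \<open>w * Y\<close> a right inverse
    of \<open>u\<close>; they coincide.\<close>
  have iso: "\<exists>x. Hom (ids e qs) (ids e ps) x \<and> x * u = ids e ps \<and> u * x = ids e qs"
    if ok: "ok ps" "ok qs" and u: "Hom (ids e ps) (ids e qs) u" "Hom (ids e qs) (ids e ps) w"
      and r: "w * u - ids e ps \<in> mats rad" "u * w - ids e qs \<in> mats rad" for ps qs u w
  proof -
    obtain X where X: "Hom (ids e ps) (ids e ps) X" "X * (w * u) = ids e ps"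
      by (rule inverse_mod_rad[OF ok(1) Hom_comp[OF u] r(1)])
    obtain Y where Y: "Hom (ids e qs) (ids e qs) Y" "(u * w) * Y = ids e qs"
      by (rule inverse_mod_rad[OF ok(2) Hom_comp[OF u(2,1)] r(2)])
    have Hw: "Hom (ids e qs) (ids e ps) (X * w)" using X(1) u(2) Hom_comp by blast
    have "X * w = X * w * (u * w * Y)" using Hw Y by (simp add: Hom_def)
    also have "\<dots> = (X * (w * u)) * (w * Y)" by (simp add: mult.assoc)
    also have "\<dots> = w * Y" using X u(2) by (simp add: Hom_def mult.assoc[symmetric])
    finally have "u * (X * w) = ids e qs" using Y by (simp add: mult.assoc)
    then show ?thesis using Hw X by (intro exI[of _ "X * w"]) (simp add: mult.assoc)
  qed
  have r: "g1 * f1 - ids e (deg1 T) \<in> mats rad" "g0 * f0 - ids e (deg0 T) \<in> mats rad"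
    "f1 * g1 - ids e (deg1 T') \<in> mats rad" "f0 * g0 - ids e (deg0 T') \<in> mats rad"
    using T(2) T'(2) by (auto simp: h minimal_def intro: mats_rad_mult)
  have ok: "ok (deg1 T)" "ok (deg0 T)" "ok (deg1 T')" "ok (deg0 T')"
    using T T' by (auto simp: valid_cplx_def)
  have H: "Hom (ids e (deg1 T)) (ids e (deg1 T')) f1" "Hom (ids e (deg1 T')) (ids e (deg1 T)) g1"
    "Hom (ids e (deg0 T)) (ids e (deg0 T')) f0" "Hom (ids e (deg0 T')) (ids e (deg0 T)) g0"
    using f g by (auto simp: cx_def)
  obtain x1 where x1: "Hom (ids e (deg1 T')) (ids e (deg1 T)) x1" "x1 * f1 = ids e (deg1 T)" "f1 * x1 = ids e (deg1 T')"
    using iso[OF ok(1,3) H(1,2) r(1,3)] by blast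
  obtain x0 where x0: "Hom (ids e (deg0 T')) (ids e (deg0 T)) x0" "x0 * f0 = ids e (deg0 T)" "f0 * x0 = ids e (deg0 T')"
    using iso[OF ok(2,4) H(3,4) r(2,4)] by blast
  have fd: "f0 * ?d = ?d' * f1" using f by (simp add: cx_def)
  have d: "Hom (ids e (deg1 T)) (ids e (deg0 T)) ?d" "Hom (ids e (deg1 T')) (ids e (deg0 T')) ?d'"
    using T(1) T'(1) by (auto simp: valid_cplx_iff cx_def)
  \<comment> \<open>The inverses in the two degrees were found independently; that they commute with
    the differentials follows from the chain map equation of \<open>f1\<close> and
    \<open>f0\<close>.\<close>
  have "x0 * ?d' = x0 * ?d' * (f1 * x1)" using d(2) x1(3) by (simp add: Hom_def mult.assoc)
  also have "\<dots> = x0 * (f0 * ?d) * x1" by (simp add: fd mult.assoc)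
  also have "\<dots> = (x0 * f0) * ?d * x1" by (simp add: mult.assoc)
  also have "\<dots> = ?d * x1" using d(1) x0(2) by (simp add: Hom_def)
  finally have "cmap (cx e T') (cx e T) x1 x0" using x1(1) x0(1) by (simp add: cx_def)
  then show thesis using that f x1 x0 by blast
qed

lemma indecomposable_heq:
  assumes T: "valid_cplx L e n T" "valid_cplx L e n T'" "heq (cx e T) (cx e T')"
    and "indecomposable L e n T"
  shows "indecomposable L e n T'"
proof -
  have "\<not> zero_K L e T'"
    using assms(4) contractible_retract[OF heq_retract[OF T(3)]] zero_K_iff T(1,2)
    unfolding indecomposable_def by blast
  moreover have "homeq L e T (dsum T1 T2)"
    if "valid_cplx L e n T1" "valid_cplx L e n T2" "homeq L e T' (dsum T1 T2)" for T1 T2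
    using that T heq_trans[OF T(3)] by (simp add: homeq_iff_heq valid_dsum)
  ultimately show ?thesis using assms(4) unfolding indecomposable_def by blast
qed

end

section \<open>Transfer between subalgebras\<close>

definition sign_split :: "(nat \<Rightarrow> int) \<Rightarrow> 'a cplx \<Rightarrow> bool" where
  "sign_split eps T \<longleftrightarrow> (\<forall>i\<in>set (deg1 T). eps i = -1) \<and> (\<forall>i\<in>set (deg0 T). eps i = 1)"

lemma orthant_sign:
  assumes "x \<in> orthant n eps"
  shows "0 \<le> real_of_int (eps i) * x i" "n \<le> i \<Longrightarrow> x i = 0"
proof -
  obtain F c where x: "x = (\<lambda>i. \<Sum>v\<in>F. c v * v i)" and
    F: "F \<subseteq> {(\<lambda>j. if j = i then real_of_int (eps i) else 0) | i. i < n}" and c: "\<forall>v\<in>F. c v \<ge> 0"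
    using assms unfolding orthant_def cone_gen_def by blast
  have v: "0 \<le> real_of_int (eps i) * v i \<and> (n \<le> i \<longrightarrow> v i = 0)" if "v \<in> F" for v
    using that F by auto
  have "real_of_int (eps i) * x i = (\<Sum>v\<in>F. c v * (real_of_int (eps i) * v i))"
    by (simp add: x sum_distrib_left mult.left_commute)
  also have "\<dots> \<ge> 0" using v c by (intro sum_nonneg mult_nonneg_nonneg[of "c _"]) auto
  finally show "0 \<le> real_of_int (eps i) * x i" .
  show "n \<le> i \<Longrightarrow> x i = 0" using v by (auto simp: x intro!: sum.neutral)
qed

lemma cone_gen_base: "v \<in> S \<Longrightarrow> v \<in> cone_gen S"
  unfolding cone_gen_def by (auto intro!: exI[of _ "{v}"] exI[of _ "\<lambda>_. 1"])

text \<open>\<open>L\<close> may fall short of \<open>A\<close> only in e^- A e^+, the maps from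
  positive to negative projectives. For complexes with negative terms in degree -1 and positive ones
  in degree 0 these are exactly the homotopies.\<close>

locale sign_subring = corner_subring n e L for n and e :: "nat \<Rightarrow> 'a::ring_1" and L +
  fixes eps :: "nat \<Rightarrow> int"
  assumes sign: "sign_vec n eps"
    and L_sign: "i < n \<Longrightarrow> j < n \<Longrightarrow> eps i = 1 \<or> eps j = -1 \<Longrightarrow> e i * x * e j \<in> L"
begin

text \<open>Between summands of these signs the morphisms do not depend on \<open>L\<close>.\<close>

lemma Hom_sign_iff:
  assumes ok: "ok ps" "ok qs" and s: "\<And>i j. i \<in> set qs \<Longrightarrow> j \<in> set ps \<Longrightarrow> eps i = 1 \<or> eps j = -1"
  shows "Hom (ids e ps) (ids e qs) X \<longleftrightarrow> ids e qs * X = X \<and> X * ids e ps = X"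
proof
  assume X: "ids e qs * X = X \<and> X * ids e ps = X"
  have "entry X q p \<in> L" for q p
  proof (cases "q < length qs \<and> p < length ps")
    case True
    have "X = ids e qs * X * ids e ps" using X by simp
    then have "entry X q p = entry (ids e qs * X * ids e ps) q p" by simp
    also have "\<dots> = e (qs ! q) * entry X q p * e (ps ! p)"
      using True by (simp only: entry_mult_ids entry_ids_mult) simp
    finally show ?thesis
      using L_sign[of "qs ! q" "ps ! p" "entry X q p"] True ok_nth ok s[of "qs ! q" "ps ! p"] by simp
  next
    case False
    have "X = ids e qs * X * ids e ps" using X by simp
    then have "entry X q p = entry (ids e qs * X * ids e ps) q p" by simp
    then show ?thesis using False L_zero by (auto simp: entry_mult_ids entry_ids_mult split: if_splits)
  qed
  then show "Hom (ids e ps) (ids e qs) X" using X unfolding Hom_def by (simp add: mats_def)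
qed (simp add: Hom_def)

text \<open>The two degrees have no index in common, and maps between different e_i A are
  radical.\<close>

lemma sign_split_minimal:
  assumes "valid_cplx L e n T" "sign_split eps T"
  shows "minimal T"
proof -
  let ?d = "trunc (length (deg0 T)) (length (deg1 T)) (dif T)"
  have ok: "ok (deg1 T)" "ok (deg0 T)" and d: "Hom (ids e (deg1 T)) (ids e (deg0 T)) ?d"
    using assms by (auto simp: valid_cplx_iff cx_def)
  have "entry ?d q p \<in> rad" for q p
  proof (rule ccontr)
    assume nr: "entry ?d q p \<notin> rad"
    then have q: "q < length (deg0 T)" and p: "p < length (deg1 T)"
      using Hom_idsD(4)[OF d] rad_zero by metis+
    then have "deg0 T ! q = deg1 T ! p"
      using not_rad_iso(1)[OF ok_nth[OF ok(2) q] ok_nth[OF ok(1) p] Hom_idsD(2)[OF d q] Hom_idsD(3)[OF d p] nr] by blast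
    moreover have "eps (deg0 T ! q) = 1" "eps (deg1 T ! p) = -1"
      using assms(2) p q by (auto simp: sign_split_def)
    ultimately show False by simp
  qed
  then show ?thesis unfolding minimal_def mats_def by blast
qed

text \<open>As the degrees share no index, nothing cancels in the class: a coordinate is negative on
  the indices of degree -1 and positive on those of degree 0.\<close>

lemma minimal_orthant_sign_split:
  assumes T: "valid_cplx L e n T" "minimal T" "rigid (cx e T) (cx e T)" and "cls T \<in> orthant n eps"
  shows "sign_split eps T"
proof -
  have dis: "set (deg1 T) \<inter> set (deg0 T) = {}" by (rule rigid_minimal_disjoint[OF T])
  have n: "i < n" if "i \<in> set (deg1 T) \<union> set (deg0 T)" for i using T(1) that by (auto simp: valid_cplx_def)
  have s: "eps i = 1 \<or> eps i = -1" if "i < n" for i using sign that by (simp add: sign_vec_def)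
  note o = orthant_sign(1)[OF assms(4)]
  have "eps i = -1" if i: "i \<in> set (deg1 T)" for i
  proof -
    have "count_list (deg0 T) i = 0" "count_list (deg1 T) i \<noteq> 0"
      using i dis by (auto simp: count_list_0_iff)
    then have "cls T i < 0" by (simp add: cls_def)
    then show ?thesis using o[of i] s[of i] n[of i] i by auto
  qed
  moreover have "eps i = 1" if i: "i \<in> set (deg0 T)" for i
  proof -
    have "count_list (deg1 T) i = 0" "count_list (deg0 T) i \<noteq> 0"
      using i dis by (auto simp: count_list_0_iff)
    then have "cls T i > 0" by (simp add: cls_def)
    then show ?thesis using o[of i] s[of i] n[of i] i by auto
  qed
  ultimately show ?thesis by (simp add: sign_split_def)
qed

text \<open>All conditions on the list are invariant under homotopy equivalence, so each summand can
  be made minimal separately. Its class is a generator of the cone and therefore lies in the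
  orthant.\<close>

lemma ex_sign_split_decomp:
  assumes Ts: "basic_presilting_decomp L e n Ts" and sub: "cone_gen (set (map cls Ts)) \<subseteq> orthant n eps"
  obtains Us where "basic_presilting_decomp L e n Us" "map cls Us = map cls Ts"
    "\<forall>U\<in>set Us. sign_split eps U"
proof -
  have V: "\<forall>T\<in>set Ts. valid_cplx L e n T" using Ts by (simp add: basic_presilting_decomp_def)
  have "\<forall>T\<in>set Ts. \<exists>T'. valid_cplx L e n T' \<and> heq (cx e T) (cx e T') \<and> cls T' = cls T \<and> minimal T'"
    using V ex_minimal by blast
  then obtain r where r: "\<And>T. T \<in> set Ts \<Longrightarrow> valid_cplx L e n (r T)"
    "\<And>T. T \<in> set Ts \<Longrightarrow> heq (cx e T) (cx e (r T))"
    "\<And>T. T \<in> set Ts \<Longrightarrow> cls (r T) = cls T" "\<And>T. T \<in> set Ts \<Longrightarrow> minimal (r T)"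
    by metis
  have rig: "rigid (cx e (r T)) (cx e (r T'))" if "T \<in> set Ts" "T' \<in> set Ts" for T T'
  proof -
    have "rigid (cx e T) (cx e T')"
      using Ts that V unfolding basic_presilting_decomp_def by (simp add: presilting_dsum_list_iff)
    then show ?thesis
      using rigid_retract_left rigid_retract_right heq_retract heq_sym r(2) that by metis
  qed
  have "basic_presilting_decomp L e n (map r Ts)"
    unfolding basic_presilting_decomp_def
  proof (intro conjI)
    show "\<forall>T\<in>set (map r Ts). valid_cplx L e n T \<and> indecomposable L e n T"
    proof
      fix U assume "U \<in> set (map r Ts)"
      then obtain T where T: "T \<in> set Ts" "U = r T" by auto
      moreover have "indecomposable L e n T" using Ts T(1) by (simp add: basic_presilting_decomp_def)
      ultimately show "valid_cplx L e n U \<and> indecomposable L e n U"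
        using V r(1,2) indecomposable_heq by blast
    qed
    show "presilting L e (dsum_list (map r Ts))"
      using rig r by (subst presilting_dsum_list_iff) auto
    show "\<forall>i<length (map r Ts). \<forall>j<length (map r Ts). i \<noteq> j \<longrightarrow> \<not> homeq L e (map r Ts ! i) (map r Ts ! j)"
    proof (intro allI impI notI)
      fix i j assume ij: "i < length (map r Ts)" "j < length (map r Ts)" "i \<noteq> j"
        and h: "homeq L e (map r Ts ! i) (map r Ts ! j)"
      have m: "Ts ! i \<in> set Ts" "Ts ! j \<in> set Ts" using ij by auto
      have "heq (cx e (r (Ts ! i))) (cx e (r (Ts ! j)))"
        using h ij m r(1) by (simp add: homeq_iff_heq)
      then have "heq (cx e (Ts ! i)) (cx e (Ts ! j))"
        using heq_trans heq_sym r(2) m by metis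
      then have "homeq L e (Ts ! i) (Ts ! j)" using V m by (simp add: homeq_iff_heq)
      then show False using Ts ij unfolding basic_presilting_decomp_def by simp
    qed
  qed
  moreover have "map cls (map r Ts) = map cls Ts" using r(3) by simp
  moreover have "sign_split eps (r T)" if T: "T \<in> set Ts" for T
  proof (rule minimal_orthant_sign_split)
    have "cls T \<in> cone_gen (set (map cls Ts))" using T by (intro cone_gen_base) simp
    then show "cls (r T) \<in> orthant n eps" using sub r(3)[OF T] by auto
  qed (use T r rig in auto)
  ultimately show thesis using that by auto
qed

lemma empty_contractible:
  "deg1 T = [] \<and> deg0 T = [] \<Longrightarrow> contractible (cx e T)"
proof -
  assume T: "deg1 T = [] \<and> deg0 T = []"
  have "cx e T = (0, 0, 0)" using T by (auto simp: cx_def intro!: fmat_eqI)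
  then show ?thesis using null_zero by simp
qed

end

text \<open>The assumptions are symmetric in \<open>L\<close> and \<open>L'\<close>. Transfer is
  proved in one direction, and the interpretation \<open>swap\<close> supplies the other.\<close>

locale sign_pair =
  A: sign_subring n e L eps + B: sign_subring n e L' eps
  for n and e :: "nat \<Rightarrow> 'a::ring_1" and L L' eps
begin

lemma Hom_transfer:
  assumes "A.ok ps" "A.ok qs" "\<And>i j. i \<in> set qs \<Longrightarrow> j \<in> set ps \<Longrightarrow> eps i = 1 \<or> eps j = -1"
  shows "A.Hom (ids e ps) (ids e qs) X \<longleftrightarrow> B.Hom (ids e ps) (ids e qs) X"
  using A.Hom_sign_iff[OF assms] B.Hom_sign_iff[OF assms] by simp

lemma valid_transfer:
  assumes "valid_cplx L e n T" "sign_split eps T"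
  shows "valid_cplx L' e n T"
proof -
  have "A.ok (deg1 T)" "A.ok (deg0 T)" using assms by (auto simp: valid_cplx_def)
  then show ?thesis
    using assms Hom_transfer[of "deg1 T" "deg0 T"] B.Hom_ids
    unfolding A.valid_cplx_iff B.valid_cplx_iff by (auto simp: cx_def sign_split_def)
qed

lemma cmap_transfer:
  assumes T: "valid_cplx L e n T" "sign_split eps T" and T': "valid_cplx L e n T'" "sign_split eps T'"
    and "A.cmap (cx e T) (cx e T') f1 f0"
  shows "B.cmap (cx e T) (cx e T') f1 f0"
proof -
  have "A.ok (deg1 T)" "A.ok (deg0 T)" "A.ok (deg1 T')" "A.ok (deg0 T')"
    using T T' by (auto simp: valid_cplx_def)
  then show ?thesis
    using assms Hom_transfer[of "deg1 T" "deg1 T'"] Hom_transfer[of "deg0 T" "deg0 T'"]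
    by (auto simp: cx_def sign_split_def)
qed

lemma rigid_transfer:
  assumes T: "valid_cplx L e n T" "sign_split eps T" and T': "valid_cplx L e n T'" "sign_split eps T'"
    and "A.rigid (cx e T) (cx e T')"
  shows "B.rigid (cx e T) (cx e T')"
proof -
  have "A.ok (deg1 T)" "A.ok (deg0 T)" "A.ok (deg1 T')" "A.ok (deg0 T')"
    using T T' by (auto simp: valid_cplx_def)
  then show ?thesis
    using assms Hom_transfer[of "deg1 T" "deg1 T'"] Hom_transfer[of "deg0 T" "deg0 T'"] Hom_transfer[of "deg1 T" "deg0 T'"]
    by (auto simp: cx_def sign_split_def)
qed

text \<open>Homotopies do depend on the algebra, but between complexes of this shape they only perturb
  the identity by a radical map, so that homotopy equivalences are isomorphisms of complexes.\<close>

lemma heq_transfer: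
  assumes T: "valid_cplx L e n T" "sign_split eps T" and T': "valid_cplx L e n T'" "sign_split eps T'"
    and "A.heq (cx e T) (cx e T')"
  shows "B.heq (cx e T) (cx e T')"
proof -
  obtain f1 f0 g1 g0 where fg: "A.cmap (cx e T) (cx e T') f1 f0" "A.cmap (cx e T') (cx e T) g1 g0"
    "g1 * f1 = ids e (deg1 T)" "g0 * f0 = ids e (deg0 T)"
    "f1 * g1 = ids e (deg1 T')" "f0 * g0 = ids e (deg0 T')"
    by (rule A.heq_minimal_iso[OF T(1) A.sign_split_minimal[OF T] T'(1) A.sign_split_minimal[OF T'] assms(5)])
  have "B.cmap (cx e T) (cx e T') f1 f0" "B.cmap (cx e T') (cx e T) g1 g0"
    using cmap_transfer[OF T T' fg(1)] cmap_transfer[OF T' T fg(2)] .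
  moreover have "B.null (cx e T) (cx e T) (g1 * f1 - ids e (deg1 T)) (g0 * f0 - ids e (deg0 T))"
    "B.null (cx e T') (cx e T') (f1 * g1 - ids e (deg1 T')) (f0 * g0 - ids e (deg0 T'))"
    using fg B.null_zero by simp_all
  ultimately show ?thesis unfolding cx_def B.heq.simps by blast
qed

text \<open>A contractible complex of this shape has no terms at all, and that does not depend on
  the algebra.\<close>

lemma contractible_transfer:
  assumes "valid_cplx L e n T" "sign_split eps T" "A.contractible (cx e T)"
  shows "B.contractible (cx e T)"
  using A.contractible_minimal_empty[OF assms(1) A.sign_split_minimal[OF assms(1,2)] assms(3)]
  by (rule B.empty_contractible)

text \<open>Given a decomposition over \<open>L'\<close>, make its summands minimal. As retracts of
  \<open>T\<close> they use only indices occurring in \<open>T\<close> in the same degree, so they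
  are sign split and the decomposition can be carried back to \<open>L\<close>.\<close>

lemma indecomposable_transfer:
  assumes T: "valid_cplx L e n T" "sign_split eps T" "indecomposable L e n T"
  shows "indecomposable L' e n T"
proof -
  interpret swap: sign_pair n e L' L eps ..
  have T': "valid_cplx L' e n T" by (rule valid_transfer[OF T(1,2)])
  have "\<not> zero_K L' e T"
    using T T' swap.contractible_transfer[OF T' T(2)]
    by (auto simp: indecomposable_def A.zero_K_iff B.zero_K_iff)
  moreover have False
    if V: "valid_cplx L' e n T1" "valid_cplx L' e n T2" and nz: "\<not> zero_K L' e T1" "\<not> zero_K L' e T2"
      and h: "homeq L' e T (dsum T1 T2)" for T1 T2
  proof -
    obtain U1 where U1: "valid_cplx L' e n U1" "B.heq (cx e T1) (cx e U1)" "B.minimal U1"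
      using B.ex_minimal[OF V(1)] by blast
    obtain U2 where U2: "valid_cplx L' e n U2" "B.heq (cx e T2) (cx e U2)" "B.minimal U2"
      using B.ex_minimal[OF V(2)] by blast
    have D: "valid_cplx L' e n (dsum U1 U2)" by (rule B.valid_dsum[OF U1(1) U2(1)])
    have "B.heq (cx e T) (cx e (dsum T1 T2))" using h T' V by (simp add: B.homeq_iff_heq B.valid_dsum)
    then have hU: "B.heq (cx e T) (cx e (dsum U1 U2))"
      using B.heq_dsum[OF V U1(1) U2(1) U1(2) U2(2)] B.heq_trans by blast
    have ret: "B.retract (cx e U1) (cx e T)" "B.retract (cx e U2) (cx e T)"
      using B.retract_trans B.retract_dsum[OF U1(1) U2(1)] B.heq_retract[OF B.heq_sym[OF hU]] by blast+
    have s: "sign_split eps U1" "sign_split eps U2"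
      using B.retract_minimal_subset[OF U1(1) T' U1(3) ret(1)]
        B.retract_minimal_subset[OF U2(1) T' U2(3) ret(2)] T(2)
      unfolding sign_split_def by blast+
    have "sign_split eps (dsum U1 U2)"
      using s by (auto simp: sign_split_def dsum_def deg1_def deg0_def)
    then have "A.heq (cx e T) (cx e (dsum U1 U2))"
      using swap.heq_transfer[OF T' T(2) D] hU by blast
    moreover have VU: "valid_cplx L e n U1" "valid_cplx L e n U2"
      using swap.valid_transfer U1(1) U2(1) s by blast+
    ultimately have hA: "homeq L e T (dsum U1 U2)" using T(1) by (simp add: A.homeq_iff_heq A.valid_dsum)
    have "\<not> zero_K L e U1"
      using contractible_transfer[OF VU(1) s(1)] B.contractible_retract[OF B.heq_retract[OF U1(2)]] nz(1) V(1) VU(1)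
      by (auto simp: A.zero_K_iff B.zero_K_iff)
    moreover have "\<not> zero_K L e U2"
      using contractible_transfer[OF VU(2) s(2)] B.contractible_retract[OF B.heq_retract[OF U2(2)]] nz(2) V(2) VU(2)
      by (auto simp: A.zero_K_iff B.zero_K_iff)
    ultimately show False using T(3) VU hA unfolding indecomposable_def by blast
  qed
  ultimately show ?thesis unfolding indecomposable_def by blast
qed

text \<open>Passing to sign split summands changes no class, so the new list spans the same cone,
  and this list also works over \<open>L'\<close>.\<close>

lemma Sigma_eps_subset: "Sigma_eps L e n eps \<subseteq> Sigma_eps L' e n eps"
proof
  interpret swap: sign_pair n e L' L eps ..
  fix \<sigma> assume "\<sigma> \<in> Sigma_eps L e n eps"
  then obtain Ts where Ts: "basic_presilting_decomp L e n Ts" "\<sigma> = cone_gen (set (map cls Ts))"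
    and sub: "\<sigma> \<subseteq> orthant n eps"
    unfolding Sigma_eps_def Sigma_fan_def by blast
  obtain Us where Us: "basic_presilting_decomp L e n Us" "map cls Us = map cls Ts"
    and s: "\<forall>U\<in>set Us. sign_split eps U"
    using A.ex_sign_split_decomp[OF Ts(1)] sub Ts(2) by blast
  have V: "\<forall>U\<in>set Us. valid_cplx L e n U" using Us(1) by (simp add: basic_presilting_decomp_def)
  then have V': "\<forall>U\<in>set Us. valid_cplx L' e n U" using s valid_transfer by blast
  have "basic_presilting_decomp L' e n Us" unfolding basic_presilting_decomp_def
  proof (intro conjI)
    show "\<forall>U\<in>set Us. valid_cplx L' e n U \<and> indecomposable L' e n U"
      using V V' s Us(1) indecomposable_transfer unfolding basic_presilting_decomp_def by blast
    show "presilting L' e (dsum_list Us)"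
      using Us(1) V V' s rigid_transfer unfolding basic_presilting_decomp_def
      by (simp add: A.presilting_dsum_list_iff B.presilting_dsum_list_iff)
    show "\<forall>i<length Us. \<forall>j<length Us. i \<noteq> j \<longrightarrow> \<not> homeq L' e (Us ! i) (Us ! j)"
    proof (intro allI impI notI)
      fix i j assume ij: "i < length Us" "j < length Us" "i \<noteq> j" and h: "homeq L' e (Us ! i) (Us ! j)"
      have m: "Us ! i \<in> set Us" "Us ! j \<in> set Us" using ij by auto
      then have "A.heq (cx e (Us ! i)) (cx e (Us ! j))"
        using swap.heq_transfer h V' s by (simp add: B.homeq_iff_heq)
      then have "homeq L e (Us ! i) (Us ! j)" using V m by (simp add: A.homeq_iff_heq)
      then show False using Us(1) ij unfolding basic_presilting_decomp_def by blast
    qed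
  qed
  moreover have "\<sigma> = cone_gen (set (map cls Us))" using Us(2) Ts(2) by simp
  ultimately show "\<sigma> \<in> Sigma_eps L' e n eps" using sub unfolding Sigma_eps_def Sigma_fan_def by blast
qed

lemma Sigma_eps_eq: "Sigma_eps L e n eps = Sigma_eps L' e n eps"
proof -
  interpret swap: sign_pair n e L' L eps ..
  show ?thesis using Sigma_eps_subset swap.Sigma_eps_subset by blast
qed

end

section \<open>The subalgebra \<open>A_eps\<close>, the induced map on classes and the
  theorem\<close>

lemma orthogonal_idems_sum_mult:
  fixes e :: "nat \<Rightarrow> 'a::ring_1"
  assumes "finite I" "finite J" "\<And>i j. i \<in> I \<Longrightarrow> j \<in> J \<Longrightarrow> e i * e j = (if i = j then e i else 0)"
  shows "(\<Sum>i\<in>I. e i) * (\<Sum>j\<in>J. e j) = (\<Sum>i\<in>I \<inter> J. e i)"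
proof -
  have "(\<Sum>i\<in>I. e i) * (\<Sum>j\<in>J. e j) = (\<Sum>i\<in>I. \<Sum>j\<in>J. if i = j then e i else 0)"
    unfolding sum_product by (intro sum.cong refl) (simp add: assms(3))
  also have "\<dots> = (\<Sum>i\<in>I. if i \<in> J then e i else 0)" using assms(2) by simp
  also have "\<dots> = (\<Sum>i\<in>I \<inter> J. e i)" using assms(1) by (simp add: sum.inter_restrict)
  finally show ?thesis .
qed

lemma K0_induced_Rn: "x \<in> Rn n \<Longrightarrow> K0_induced n x = x"
  by (rule ext) (auto simp: K0_induced_def Rn_def if_distrib[of "\<lambda>y. _ * y"] cong: if_cong)

text \<open>\<open>K0_induced n\<close> is the identity on \<open>Rn n\<close> but sets the
  coordinates from \<open>n\<close> on to 0. It fixes a cone once the cone is known to lie in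
  \<open>Rn n\<close>.\<close>

lemma fan_iso_K0_induced:
  assumes "\<And>\<sigma>. \<sigma> \<in> S \<Longrightarrow> \<sigma> \<subseteq> Rn n"
  shows "fan_iso n (K0_induced n) S S"
proof -
  have im: "K0_induced n ` \<sigma> = \<sigma>" if "\<sigma> \<subseteq> Rn n" for \<sigma>
    using that K0_induced_Rn by force
  have "bij_betw (K0_induced n) (Zn n) (Zn n)"
    by (subst bij_betw_cong[of _ _ id]) (auto simp: Zn_def K0_induced_Rn)
  moreover have "bij_betw (\<lambda>\<sigma>. K0_induced n ` \<sigma>) S S"
    by (subst bij_betw_cong[of _ _ id]) (auto simp: im assms)
  moreover have "(\<lambda>i. x i + y i) \<in> Rn n" "(\<lambda>i. c * x i) \<in> Rn n" if "x \<in> Rn n" "y \<in> Rn n" for x y c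
    using that by (auto simp: Rn_def)
  ultimately show ?thesis unfolding fan_iso_def using K0_induced_Rn im[of "Rn n"]
    by (simp add: K0_induced_Rn)
qed

lemma A_eps_I: "p * x * p + p * y * m + m * z * m \<in> A_eps n e eps"
  if "p = e_plus n e eps" "m = e_minus n e eps"
  unfolding A_eps_def Let_def using that by blast

lemma sign_subring_A_eps:
  fixes e :: "nat \<Rightarrow> 'a::ring_1"
  assumes "basic_idems n e" and c: "complete_orth_prim_idems n e" and sign: "sign_vec n eps"
  shows "sign_subring n e (A_eps n e eps) eps"
proof -
  interpret basic_idems n e by fact
  define p m where "p = e_plus n e eps" and "m = e_minus n e eps"
  have mult: "e i * e j = (if i = j then e i else 0)" if "i < n" "j < n" for i j
    using c that idem unfolding complete_orth_prim_idems_def by auto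
  have pm: "p * p = p" "m * m = m" "p * m = 0" "m * p = 0"
    unfolding p_def m_def e_plus_def e_minus_def
    by (subst orthogonal_idems_sum_mult; auto simp: mult intro!: sum.neutral)+
  have ep: "p * e i = e i" "e i * p = e i" if "i < n" "eps i = 1" for i
    using orthogonal_idems_sum_mult[of "{i. i < n \<and> eps i = 1}" "{i}" e]
      orthogonal_idems_sum_mult[of "{i}" "{i. i < n \<and> eps i = 1}" e] that
    unfolding p_def e_plus_def by (auto simp: mult)
  have em: "m * e i = e i" "e i * m = e i" if "i < n" "eps i = -1" for i
    using orthogonal_idems_sum_mult[of "{i. i < n \<and> eps i = -1}" "{i}" e]
      orthogonal_idems_sum_mult[of "{i}" "{i. i < n \<and> eps i = -1}" e] that
    unfolding m_def e_minus_def by (auto simp: mult)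
  have I: "p * x * p + p * y * m + m * z * m \<in> A_eps n e eps" for x y z
    by (rule A_eps_I[OF p_def m_def])
  have E: "\<exists>x y z. a = p * x * p + p * y * m + m * z * m" if "a \<in> A_eps n e eps" for a
    using that unfolding A_eps_def Let_def p_def m_def by blast
  have S: "e i * x * e j \<in> A_eps n e eps" if ij: "i < n" "j < n" "eps i = 1 \<or> eps j = -1" for i j x
  proof -
    let ?x = "e i * x * e j"
    have s: "eps i = 1 \<or> eps i = -1" "eps j = 1 \<or> eps j = -1" using sign ij by (auto simp: sign_vec_def)
    then consider "eps i = 1" "eps j = 1" | "eps i = 1" "eps j = -1" | "eps i = -1" "eps j = -1"
      using ij(3) by auto
    then show ?thesis
    proof cases
      case 1
      then have "?x = p * ?x * p" using ep ij by (metis mult.assoc)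
      then show ?thesis using I[of ?x 0 0] by simp
    next
      case 2
      then have "?x = p * ?x * m" using ep em ij by (metis mult.assoc)
      then show ?thesis using I[of 0 ?x 0] by simp
    next
      case 3
      then have "?x = m * ?x * m" using em ij by (metis mult.assoc)
      then show ?thesis using I[of 0 0 ?x] by simp
    qed
  qed
  show ?thesis
  proof unfold_locales
    show "0 \<in> A_eps n e eps" using I[of 0 0 0] by simp
    show "a + b \<in> A_eps n e eps" if ab0: "a \<in> A_eps n e eps" "b \<in> A_eps n e eps" for a b
    proof -
      obtain x y z x' y' z' where "a = p * x * p + p * y * m + m * z * m" "b = p * x' * p + p * y' * m + m * z' * m"
        using E[OF ab0(1)] E[OF ab0(2)] by blast
      then have "a + b = p * (x + x') * p + p * (y + y') * m + m * (z + z') * m" by (simp add: algebra_simps)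
      then show ?thesis using I by simp
    qed
    show "a - b \<in> A_eps n e eps" if ab0: "a \<in> A_eps n e eps" "b \<in> A_eps n e eps" for a b
    proof -
      obtain x y z x' y' z' where "a = p * x * p + p * y * m + m * z * m" "b = p * x' * p + p * y' * m + m * z' * m"
        using E[OF ab0(1)] E[OF ab0(2)] by blast
      then have "a - b = p * (x - x') * p + p * (y - y') * m + m * (z - z') * m" by (simp add: algebra_simps)
      then show ?thesis using I by simp
    qed
    show "a * b \<in> A_eps n e eps" if ab0: "a \<in> A_eps n e eps" "b \<in> A_eps n e eps" for a b
    proof -
      obtain x y z x' y' z' where ab: "a = p * x * p + p * y * m + m * z * m" "b = p * x' * p + p * y' * m + m * z' * m"
        using E[OF ab0(1)] E[OF ab0(2)] by blast
      have pm': "p * (p * w) = p * w" "m * (m * w) = m * w" "p * (m * w) = 0" "m * (p * w) = 0" for w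
        using pm by (simp_all add: mult.assoc[symmetric])
      \<comment> \<open>Multiplication of upper triangular block matrices: \<open>m * p = 0\<close>
        removes the lower left block, and the upper right one collects the two mixed
        products.\<close>
      have "a * b = p * (x * p * x') * p + p * (x * p * y' + y * m * z') * m + m * (z * m * z') * m"
        unfolding ab by (simp add: algebra_simps pm pm')
      then show ?thesis using I by simp
    qed
    show "e i * x * e i \<in> A_eps n e eps" if "i < n" for i x
      using S[of i i] that sign by (auto simp: sign_vec_def)
  qed (use S sign in auto)
qed

theorem theorem4p23:
  fixes scale :: "'k::field \<Rightarrow> 'a::ring_1 \<Rightarrow> 'a"
    and n :: nat and e :: "nat \<Rightarrow> 'a" and eps :: "nat \<Rightarrow> int"
  assumes "k_algebra scale"
    and "finite_dimensional_alg scale"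
    and "complete_orth_prim_idems n e"
    and "basic_alg n e"
    and "sign_vec n eps"
  shows "fan_iso n (K0_induced n) (Sigma_eps (A_eps n e eps) e n eps) (Sigma_eps UNIV e n eps)"
proof -
  have prim: "primitive_idem (e i)" if "i < n" for i
    using assms(3) that by (simp add: complete_orth_prim_idems_def)
  have b: "basic_idems n e"
    using prim primitive_idem_local[OF assms(1,2)] assms(4) by unfold_locales auto
  interpret basic_idems n e by (rule b)
  interpret A: sign_subring n e "A_eps n e eps" eps by (rule sign_subring_A_eps[OF b assms(3,5)])
  interpret B: sign_subring n e UNIV eps by unfold_locales (simp_all add: assms(5))
  interpret sign_pair n e "A_eps n e eps" UNIV eps ..
  have "\<sigma> \<subseteq> Rn n" if "\<sigma> \<in> Sigma_eps UNIV e n eps" for \<sigma>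
    using that orthant_sign(2)[of _ n eps] unfolding Sigma_eps_def Rn_def by blast
  then show ?thesis unfolding Sigma_eps_eq by (rule fan_iso_K0_induced)
qed

end
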